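(* Every irrational real number $\xi$ with $\mu(\xi)<\frac53+\frac{4}{15}\sqrt{10}$ satisfies $\lim_{n\to\infty}\big(p(n,\xi,b)-n\big)=+\infty$ for every integer $b\ge2$. Furthermore, for every integer $b\ge2$ there exists an irrational real number $\xi_b$ with $\mu(\xi_b)=\frac53+\frac4{15}\sqrt{10}$ and $p(n,\xi_b,b)=n+1$ for all $n\ge1$.
   Context: For an integer $b\ge2$, every real $\xi$ is uniquely written $\xi=\lfloor\xi\rfloor+\sum_{\ell\ge1}a_\ell b^{-\ell}$ with digits $a_\ell\in\{0,\ldots,b-1\}$ and $a_\ell\ne b-1$ for infinitely many $\ell$; $p(n,\xi,b)=\#\{a_{\ell+1}a_{\ell+2}\cdots a_{\ell+n}:\ell\ge0\}$. The irrationality exponent $\mu(\xi)$ is the supremum of the real $\mu$ such that $|\xi-p/q|<q^{-\mu}$ has infinitely many rational solutions $p/q$. *)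

theory Defs
  imports "HOL-Analysis.Analysis" "HOL-Library.Extended_Real"
begin

(* l-th digit (l >= 1) of the base-b expansion of xi, the expansion not ending in (b-1)^omega *)
definition digit :: "real \<Rightarrow> nat \<Rightarrow> nat \<Rightarrow> nat" where
  "digit xi b l = nat (\<lfloor>xi * real b ^ l\<rfloor> mod int b)"

definition complexity :: "nat \<Rightarrow> real \<Rightarrow> nat \<Rightarrow> nat" where
  "complexity n xi b = card {map (\<lambda>i. digit xi b (l + 1 + i)) [0..<n] | l. True}"

definition irrationality_exponent :: "real \<Rightarrow> ereal" where
  "irrationality_exponent xi =
     Sup {ereal mu | mu. infinite {pq :: int \<times> int. snd pq \<ge> 1 \<and>
            \<bar>xi - real_of_int (fst pq) / real_of_int (snd pq)\<bar> < real_of_int (snd pq) powr (- mu)}}"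

end

(*
  Let sigma = 2/3 + 4/15 sqrt 10, so that the critical exponent is 1 + sigma.

  If the same n letters occur at positions i < j of the digit word, then q = b^j - b^i satisfies
  |q xi - p| < b^-n, an approximation of exponent 1 + n/j. So for the first part it suffices to find
  repetitions with n/j arbitrarily close to sigma. If p(n) - n does not tend to infinity, then
  p(n+1) = p(n) + 1 for all large n, and after deletion of a prefix the digit word is, at infinitely
  many scales, a suffix (of length c) of a block X followed by a sequence of blocks X and Y. Since
  there is only one right special factor of each large length, one of the squares XX, YY does not
  occur, and regrouping the blocks gives the next scale. With x = |X|, y = |Y| and T = y + c a step is
  (x, y, T) -> (x + y, x, T + x) or (x, y, T) -> (x + y, y, T) (a third kind of step is excluded by
  the bounds), and the repetitions visible at each scale give T <= s x and x + y <= s T if s bounds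
  all n/j. For s <= 1.51 these inequalities force the two kinds of steps to follow a pattern of
  period 4. Along this pattern T - (2x + 4y)/3 is constant and y/x tends to sqrt(2/5), hence T/x
  tends to sigma and s >= sigma.

  For the second part the word that follows this pattern from the first scale on is taken as digit
  word. Its repetitions give approximations with denominators about b^t, for t in a sequence whose
  ratios of consecutive terms have upper limit sigma, and with errors comparable to b^-(t + t'),
  t' being the term after t. Comparing an arbitrary fraction p/q with the approximation for which
  b^t <= q < b^t' shows that no exponent exceeds 1 + sigma.
*)
theory Submission
  imports Defs "HOL-Library.Sublist"
begin

section \<open>Factors of infinite words\<close>

definition factor :: "(nat \<Rightarrow> 'a) \<Rightarrow> nat \<Rightarrow> nat \<Rightarrow> 'a list" where
  "factor z p n = map z [p..<p + n]"

definition factors :: "(nat \<Rightarrow> 'a) \<Rightarrow> nat \<Rightarrow> 'a list set" where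
  "factors z n = range (\<lambda>p. factor z p n)"

definition eventually_periodic :: "(nat \<Rightarrow> 'a) \<Rightarrow> bool" where
  "eventually_periodic z \<longleftrightarrow> (\<exists>s t. 0 < t \<and> (\<forall>i\<ge>s. z (i + t) = z i))"

lemma length_factor [simp]: "length (factor z p n) = n"
  by (simp add: factor_def)

lemma nth_factor [simp]: "i < n \<Longrightarrow> factor z p n ! i = z (p + i)"
  by (simp add: factor_def)

lemma factor_eq_iff: "factor z p n = u \<longleftrightarrow> length u = n \<and> (\<forall>i<n. z (p + i) = u ! i)"
  by (auto simp: list_eq_iff_nth_eq)

lemma factor_eq_factor_iff: "factor z p n = factor y q n \<longleftrightarrow> (\<forall>i<n. z (p + i) = y (q + i))"
  by (auto simp: list_eq_iff_nth_eq)

lemma factor_add: "factor z p (m + n) = factor z p m @ factor z (p + m) n"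
  by (auto simp: list_eq_iff_nth_eq nth_append)

lemma factor_Suc: "factor z p (Suc n) = factor z p n @ [z (p + n)]"
  by (simp add: factor_def)

lemma factor_Suc_Cons: "factor z p (Suc n) = z p # factor z (Suc p) n"
  by (simp add: factor_def upt_conv_Cons del: upt_Suc)

lemma factor_shift: "factor (\<lambda>i. z (i + k)) p n = factor z (p + k) n"
  by (auto simp: list_eq_iff_nth_eq add_ac)

lemma take_drop_factor: "k + n \<le> m \<Longrightarrow> take n (drop k (factor z p m)) = factor z (p + k) n"
  by (auto simp: list_eq_iff_nth_eq add_ac)

lemma factor_in_factors [simp]: "factor z p n \<in> factors z n"
  by (simp add: factors_def)

lemma take_prefix: "prefix w u \<Longrightarrow> take (length w) u = w"
  by (auto simp: prefix_def)

lemma finite_factors: "finite (range z) \<Longrightarrow> finite (factors z n)"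
proof -
  assume "finite (range z)"
  then have "finite {xs. set xs \<subseteq> range z \<and> length xs = n}" by (rule finite_lists_length_eq)
  then show ?thesis by (rule finite_subset[rotated]) (auto simp: factors_def factor_def)
qed

section \<open>Right special factors and the growth of the number of factors\<close>

lemma butlast_factors: "butlast ` factors z (Suc n) = factors z n"
  by (simp add: factors_def factor_Suc image_image)

text \<open>Pigeonhole gives two occurrences of one factor of length \<open>n\<close>;
  \<open>det\<close> forces equal next letters again and again, so the two tails agree and their
  distance is a period.\<close>

lemma periodic_if_no_right_special:
  assumes fin: "finite (range z)"
    and det: "\<And>p q. factor z p n = factor z q n \<Longrightarrow> z (p + n) = z (q + n)"
  shows "eventually_periodic z"
proof -
  have "\<not> inj (\<lambda>p. factor z p n)"
    using finite_factors[OF fin, of n] unfolding factors_def by (auto dest: finite_imageD)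
  then obtain i j where ij: "i < j" "factor z i n = factor z j n"
    unfolding inj_on_def by (metis nat_neq_iff)
  have eq: "factor z (i + m) n = factor z (j + m) n" for m
  proof (induction m)
    case (Suc m)
    have "factor z (i + m) (Suc n) = factor z (j + m) (Suc n)"
      using Suc det[OF Suc] by (simp add: factor_Suc)
    then show ?case by (simp add: factor_Suc_Cons)
  qed (use ij in simp)
  have "z (l + (j - i)) = z l" if "l \<ge> i + n" for l
    using det[OF eq[of "l - i - n"]] that ij(1) by (simp add: algebra_simps)
  then show ?thesis using ij(1) unfolding eventually_periodic_def
    by (intro exI[of _ "i + n"] exI[of _ "j - i"]) simp
qed

lemma eventually_periodic_shift:
  "eventually_periodic (\<lambda>i. z (i + k)) \<Longrightarrow> eventually_periodic z"
proof -
  assume "eventually_periodic (\<lambda>i. z (i + k))"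
  then obtain s t where st: "0 < t" "\<And>i. s \<le> i \<Longrightarrow> z (i + t + k) = z (i + k)"
    unfolding eventually_periodic_def by blast
  have "z (i + t) = z i" if "s + k \<le> i" for i
    using st(2)[of "i - k"] that by simp
  then show ?thesis using st(1) unfolding eventually_periodic_def by blast
qed

lemma right_special_beyond:
  assumes "finite (range z)" "\<not> eventually_periodic z"
  obtains p q where "p \<ge> k" "q \<ge> k" "factor z p n = factor z q n" "z (p + n) \<noteq> z (q + n)"
proof -
  have "\<not> eventually_periodic (\<lambda>i. z (i + k))" using assms(2) eventually_periodic_shift by blast
  moreover have "finite (range (\<lambda>i. z (i + k)))" using assms(1) by (rule finite_subset[rotated]) auto
  ultimately obtain p q where "factor (\<lambda>i. z (i + k)) p n = factor (\<lambda>i. z (i + k)) q n" "z (p + n + k) \<noteq> z (q + n + k)"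
    using periodic_if_no_right_special[of "\<lambda>i. z (i + k)" n] by blast
  then show thesis by (intro that[of "p + k" "q + k"]) (auto simp: factor_shift add_ac)
qed

text \<open>Deleting the last letter maps the factors of length \<open>Suc n\<close> onto those of
  length \<open>n\<close>, and a right special factor has two preimages. Iterated, this is the
  Morse-Hedlund bound.\<close>

lemma card_factors_Suc:
  assumes "finite (range z)" "\<not> eventually_periodic z"
  shows "card (factors z n) < card (factors z (Suc n))"
proof -
  obtain p q where pq: "factor z p n = factor z q n" "z (p + n) \<noteq> z (q + n)"
    using right_special_beyond[OF assms, of 0 n] by blast
  let ?F = "factors z (Suc n)"
  have fin: "finite ?F" using assms(1) by (rule finite_factors)
  have "butlast ` ?F \<subseteq> butlast ` (?F - {factor z p (Suc n)})"
  proof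
    fix v assume "v \<in> butlast ` ?F"
    then obtain u where u: "u \<in> ?F" "v = butlast u" by blast
    show "v \<in> butlast ` (?F - {factor z p (Suc n)})"
    proof (cases "u = factor z p (Suc n)")
      case True
      then have "v = butlast (factor z q (Suc n))" using u pq by (simp add: factor_Suc)
      moreover have "factor z q (Suc n) \<noteq> factor z p (Suc n)" using pq by (simp add: factor_Suc)
      ultimately show ?thesis by auto
    qed (use u in blast)
  qed
  then have "card (butlast ` ?F) \<le> card (butlast ` (?F - {factor z p (Suc n)}))" using fin by (intro card_mono) auto
  then have "card (factors z n) \<le> card (?F - {factor z p (Suc n)})"
    using card_image_le[of "?F - {factor z p (Suc n)}" butlast] fin by (simp add: butlast_factors)
  also have "\<dots> < card ?F" using fin by (intro psubset_card_mono) (auto simp: factors_def)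
  finally show ?thesis .
qed

lemma card_factors_ge:
  assumes "finite (range z)" "\<not> eventually_periodic z"
  shows "n < card (factors z n)"
proof (induction n)
  case 0
  have "finite (factors z 0)" "factors z 0 \<noteq> {}" using finite_factors[OF assms(1)] by (auto simp: factors_def)
  then show ?case by (simp add: card_gt_0_iff)
next
  case (Suc n)
  then show ?case using card_factors_Suc[OF assms, of n] by linarith
qed

text \<open>Both \<open>a\<close> and \<open>b\<close> can be removed without changing the image.
  Taking \<open>a'\<close> and \<open>b'\<close> distinct treats two right special factors; taking
  them equal treats one factor with three right extensions.\<close>

lemma card_butlast_image:
  assumes fin: "finite F" and F: "a \<in> F" "b \<in> F" "a' \<in> F" "b' \<in> F" and ab: "a \<noteq> b"
    and ne: "a' \<noteq> a" "a' \<noteq> b" "b' \<noteq> a" "b' \<noteq> b"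
    and eq: "butlast a' = butlast a" "butlast b' = butlast b"
  shows "card (butlast ` F) + 2 \<le> card F"
proof -
  have "butlast ` F \<subseteq> butlast ` (F - {a, b})"
  proof
    fix v assume "v \<in> butlast ` F"
    then obtain u where u: "u \<in> F" "v = butlast u" by blast
    show "v \<in> butlast ` (F - {a, b})"
    proof (cases "u = a")
      case True
      then have "v = butlast a'" using u eq by simp
      then show ?thesis using F ne by blast
    next
      case False
      show ?thesis
      proof (cases "u = b")
        case True
        then have "v = butlast b'" using u eq by simp
        then show ?thesis using F ne by blast
      qed (use u False in blast)
    qed
  qed
  then have "card (butlast ` F) \<le> card (butlast ` (F - {a, b}))" using fin by (intro card_mono) auto
  also have "\<dots> \<le> card (F - {a, b})" using fin by (intro card_image_le) auto
  also have "\<dots> = card F - 2" using F ab fin by (simp add: card_Diff_subset)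
  finally have "card (butlast ` F) \<le> card F - 2" .
  moreover have "card {a, b} \<le> card F" using F fin by (intro card_mono) auto
  ultimately show ?thesis using ab by simp
qed

text \<open>Only uniqueness is encoded; the existence of a right special factor of each length comes
  from non-periodicity.\<close>

definition unique_right_special :: "(nat \<Rightarrow> 'a) \<Rightarrow> nat \<Rightarrow> bool" where
  "unique_right_special z n \<longleftrightarrow> (\<forall>p q p' q'. factor z p n = factor z q n \<longrightarrow> z (p + n) \<noteq> z (q + n) \<longrightarrow>
     factor z p' n = factor z q' n \<longrightarrow> z (p' + n) \<noteq> z (q' + n) \<longrightarrow> factor z p n = factor z p' n)"

lemma unique_right_special_if_card:
  assumes fin: "finite (range z)" and card: "card (factors z (Suc n)) \<le> Suc (card (factors z n))"
  shows "unique_right_special z n"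
  unfolding unique_right_special_def
proof (intro allI impI, rule ccontr)
  fix p q p' q'
  assume h: "factor z p n = factor z q n" "z (p + n) \<noteq> z (q + n)"
    "factor z p' n = factor z q' n" "z (p' + n) \<noteq> z (q' + n)" "factor z p n \<noteq> factor z p' n"
  have "card (butlast ` factors z (Suc n)) + 2 \<le> card (factors z (Suc n))"
    by (rule card_butlast_image[of _ "factor z p (Suc n)" "factor z p' (Suc n)" "factor z q (Suc n)" "factor z q' (Suc n)"])
      (use h finite_factors[OF fin] in \<open>simp_all, simp_all add: factor_Suc\<close>)
  then show False using card by (simp add: butlast_factors)
qed

lemma two_right_extensions_if_card:
  assumes fin: "finite (range z)" and card: "card (factors z (Suc n)) \<le> Suc (card (factors z n))"
    and h: "factor z p n = factor z q n" "z (p + n) \<noteq> z (q + n)" "factor z r n = factor z p n"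
  shows "z (r + n) = z (p + n) \<or> z (r + n) = z (q + n)"
proof (rule ccontr)
  assume "\<not> ?thesis"
  then have "card (butlast ` factors z (Suc n)) + 2 \<le> card (factors z (Suc n))"
    by (intro card_butlast_image[of _ "factor z p (Suc n)" "factor z q (Suc n)" "factor z r (Suc n)" "factor z r (Suc n)"])
      (use h finite_factors[OF fin] in \<open>simp_all, simp_all add: factor_Suc\<close>)
  then show False using card by (simp add: butlast_factors)
qed

lemma unique_right_special_shift: "unique_right_special z n \<Longrightarrow> unique_right_special (\<lambda>i. z (i + k)) n"
  unfolding unique_right_special_def factor_shift
proof (intro allI impI)
  fix p q p' q'
  assume *: "\<forall>p q p' q'. factor z p n = factor z q n \<longrightarrow> z (p + n) \<noteq> z (q + n) \<longrightarrow>
     factor z p' n = factor z q' n \<longrightarrow> z (p' + n) \<noteq> z (q' + n) \<longrightarrow> factor z p n = factor z p' n"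
    and h: "factor z (p + k) n = factor z (q + k) n" "z (p + n + k) \<noteq> z (q + n + k)"
    "factor z (p' + k) n = factor z (q' + k) n" "z (p' + n + k) \<noteq> z (q' + n + k)"
  show "factor z (p + k) n = factor z (p' + k) n"
    by (rule *[rule_format, of _ "q + k" _ "q' + k"]) (use h in \<open>simp_all add: add_ac\<close>)
qed

text \<open>The windows are indexed by a block and an offset in it; offset 0 yields \<open>w\<close>
  for both blocks, which saves one.\<close>

lemma card_factors_if_covered:
  assumes ne: "X \<noteq> []" "Y \<noteq> []" and w: "prefix w (X @ w)" "prefix w (Y @ w)"
    and cover: "\<And>p. \<exists>v\<in>{X, Y}. \<exists>k<length v. factor z p (length w) = take (length w) (drop k (v @ w))"
  shows "card (factors z (length w)) \<le> length X + length Y - 1"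
proof -
  let ?g = "\<lambda>v k. take (length w) (drop k (v @ w))"
  have w0: "?g v 0 = w" if "v \<in> {X, Y}" for v
    using w that by (auto simp only: take_prefix drop_0)
  have "factors z (length w) \<subseteq> ?g X ` {..<length X} \<union> ?g Y ` {1..<length Y}"
  proof
    fix u assume "u \<in> factors z (length w)"
    then obtain p where "u = factor z p (length w)" by (auto simp: factors_def)
    then obtain v k where v: "v \<in> {X, Y}" "k < length v" "u = ?g v k" using cover by metis
    show "u \<in> ?g X ` {..<length X} \<union> ?g Y ` {1..<length Y}"
    proof (cases "k = 0")
      case True
      then have "u = ?g X 0" using v w0 by simp
      then show ?thesis using ne by blast
    qed (use v in auto)
  qed
  then have "card (factors z (length w)) \<le> card (?g X ` {..<length X} \<union> ?g Y ` {1..<length Y})"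
    by (intro card_mono) auto
  also have "\<dots> \<le> card (?g X ` {..<length X}) + card (?g Y ` {1..<length Y})" by (rule card_Un_le)
  also have "\<dots> \<le> length X + (length Y - 1)"
    using card_image_le[of "{..<length X}" "?g X"] card_image_le[of "{1..<length Y}" "?g Y"] by simp
  finally show ?thesis using ne by (cases Y) auto
qed

section \<open>Bounds on the orbits of the block lengths\<close>

text \<open>The linear step preserves T - (2 x + 4 y) / 3 and, up to sign, 2 x^2 - 5 y^2. As x
  grows, y/x tends to sqrt (2/5) and therefore T/x to 2/3 + 4/15 sqrt 10, which contradicts the
  bound by \<open>s\<close>.\<close>

lemma quadratic_orbit_bound:
  fixes x y T :: "nat \<Rightarrow> real" and s :: real
  assumes s: "s < 2/3 + 4/15 * sqrt 10"
    and pos: "\<And>i. 0 < x i" "\<And>i. 0 < y i"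
    and bound: "\<And>i. T i \<le> s * x i"
    and step: "\<And>i. x (Suc i) = 3 * x i + 5 * y i" "\<And>i. y (Suc i) = 2 * x i + 3 * y i"
      "\<And>i. T (Suc i) = T i + 4 * x i + 6 * y i"
  shows False
proof -
  define F where "F = T 0 - (2 * x 0 + 4 * y 0) / 3"
  have F: "T i - (2 * x i + 4 * y i) / 3 = F" for i
    by (induction i) (auto simp: F_def step field_simps)
  define E where "E = \<bar>2 * (x 0)\<^sup>2 - 5 * (y 0)\<^sup>2\<bar>"
  have E: "\<bar>2 * (x i)\<^sup>2 - 5 * (y i)\<^sup>2\<bar> = E" for i
  proof (induction i)
    case (Suc i)
    have "2 * (x (Suc i))\<^sup>2 - 5 * (y (Suc i))\<^sup>2 = - (2 * (x i)\<^sup>2 - 5 * (y i)\<^sup>2)"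
      unfolding step by (simp add: power2_eq_square algebra_simps)
    then show ?case using Suc by simp
  qed (simp add: E_def)
  have grow: "x i \<ge> 3 ^ i * x 0" for i
  proof (induction i)
    case (Suc i)
    then show ?case using pos(2)[of i] unfolding step by simp
  qed simp
  \<comment> \<open>\<open>r\<close> is the limit of y/x, and \<open>d\<close> is the slack, scaled
    so that \<open>s = 2/3 + 4/3 * (r - d)\<close>.\<close>
  define r where "r = sqrt 10 / 5"
  define d where "d = (2/3 + 4/15 * sqrt 10 - s) * (3/4)"
  have d: "d > 0" and r: "r > 0" and r2: "r\<^sup>2 = 2/5"
    using s by (auto simp: d_def r_def power_divide)
  have s_eq: "s = 2/3 + 4/3 * (r - d)"
    by (simp add: d_def r_def field_simps)
  have y_le: "y i \<le> (r - d) * x i + \<bar>F\<bar>" for i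
  proof -
    have "(2 * x i + 4 * y i) / 3 + F \<le> (2/3 + 4/3 * (r - d)) * x i"
      using bound[of i] F[of i] unfolding s_eq by linarith
    then have "4 * y i \<le> 4 * ((r - d) * x i) + 3 * \<bar>F\<bar>" by (simp add: field_simps)
    then show ?thesis by linarith
  qed
  \<comment> \<open>Chosen so that \<open>x i > M\<close> makes both invariants negligible: 2 |F| is
    at most \<open>d * a\<close>, \<open>E\<close> is below \<open>d * r * a\<close>, and
    \<open>a\<close> is at least 1.\<close>
  define M where "M = 2 * \<bar>F\<bar> / d + E / (d * r) + 1"
  obtain i where i: "3 ^ i > (M + 1) / x 0"
    using real_arch_pow[of 3 "(M + 1) / x 0"] by auto
  define a where "a = x i"
  have "M < a" using i grow[of i] pos(1)[of 0] by (simp add: a_def field_simps)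
  moreover have "E \<ge> 0" by (simp add: E_def)
  moreover have "0 \<le> 2 * \<bar>F\<bar> / d" using d by simp
  moreover have "0 \<le> E / (d * r)" using d r \<open>E \<ge> 0\<close> by simp
  ultimately have "2 * \<bar>F\<bar> / d < a" "E / (d * r) < a" and a1: "1 \<le> a"
    unfolding M_def by linarith+
  then have F_le: "2 * \<bar>F\<bar> \<le> d * a" and E_le: "E < d * r * a"
    using d r by (auto simp: field_simps)
  have y1: "y i \<le> (r - d/2) * a" using y_le[of i] F_le unfolding a_def by (simp add: algebra_simps)
  have "0 < (r - d/2) * a" using y1 pos(2)[of i] by linarith
  then have rd: "0 < r - d/2" using a1 by (simp add: zero_less_mult_iff)
  have "(y i)\<^sup>2 \<le> ((r - d/2) * a)\<^sup>2" using y1 pos(2)[of i] by (intro power_mono) auto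
  also have "\<dots> \<le> (r * (r - d/2)) * a\<^sup>2"
    unfolding power_mult_distrib using rd d
    by (intro mult_right_mono) (auto simp: power2_eq_square intro!: mult_right_mono)
  also have "\<dots> = (2/5) * a\<^sup>2 - (d * r / 2) * a\<^sup>2"
    using r2 by (simp add: power2_eq_square algebra_simps)
  finally have "5 * (y i)\<^sup>2 \<le> 2 * a\<^sup>2 - 5/2 * (d * r * a\<^sup>2)" by simp
  moreover have "2 * a\<^sup>2 - 5 * (y i)\<^sup>2 \<le> E" using E[of i] unfolding a_def by linarith
  moreover have "d * r * a \<le> d * r * a\<^sup>2"
    using a1 d r by (intro mult_left_mono) (auto simp: power2_eq_square)
  moreover have "0 \<le> d * r * a" using a1 d r by simp
  ultimately show False using E_le by linarith
qed

text \<open>With a rational number in place of \<open>s\<close> the orbit inequalities become linear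
  with constant coefficients, so that impossible step patterns are refuted by linear
  arithmetic.\<close>

lemma sigma_less: "2/3 + 4/15 * sqrt 10 < (151/100 :: real)"
proof -
  have "sqrt 10 < (3.1625 :: real)" by (rule real_less_lsqrt) (auto simp: power2_eq_square)
  then show ?thesis by simp
qed

text \<open>\<open>m i\<close> selects between the two kinds of step. The bounds leave only one
  eventual pattern, whose period composes to the linear step of
  \<open>quadratic_orbit_bound\<close>.\<close>

lemma balanced_orbit_bound:
  fixes x y T :: "nat \<Rightarrow> real" and s :: real and m :: "nat \<Rightarrow> bool"
  assumes s: "s < 2/3 + 4/15 * sqrt 10"
    and pos: "\<And>i. 0 < x i" "\<And>i. 0 < y i" and T: "\<And>i. y i \<le> T i" "\<And>i. T i \<le> x i + y i"
    and bound: "\<And>i. T i \<le> s * x i" "\<And>i. x i + y i \<le> s * T i"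
    and x_Suc: "\<And>i. x (Suc i) = x i + y i"
    and y_Suc: "\<And>i. m i \<Longrightarrow> y (Suc i) = x i" "\<And>i. \<not> m i \<Longrightarrow> y (Suc i) = y i"
    and T_Suc: "\<And>i. m i \<Longrightarrow> T (Suc i) = T i + x i" "\<And>i. \<not> m i \<Longrightarrow> T (Suc i) = T i"
  shows False
proof -
  have b: "100 * T i \<le> 151 * x i" "100 * x i + 100 * y i \<le> 151 * T i" for i
  proof -
    have "s * x i \<le> 151/100 * x i" "s * T i \<le> 151/100 * T i"
      using s sigma_less pos(1)[of i] pos(2)[of i] T(1)[of i] by (intro mult_right_mono; linarith)+
    then show "100 * T i \<le> 151 * x i" "100 * x i + 100 * y i \<le> 151 * T i"
      using bound(1)[of i] bound(2)[of i] by linarith+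
  qed
  have suc: "Suc i = i + 1" "Suc (i + 1) = i + 2" "Suc (i + 2) = i + 3" "Suc (i + 3) = i + 4"
    "Suc (i + 4) = i + 5" for i :: nat by simp_all
  txt \<open>Writing \<open>b\<close> for a step with \<open>m i\<close> and \<open>c\<close> for one without, the patterns \<open>bcc\<close>, \<open>cbc\<close>, \<open>bbbb\<close> and
    \<open>bcbbc\<close> are infeasible, so that \<open>cbbb\<close> is eventually repeated.\<close>
  have n1: "m (Suc (Suc i))" if m: "m i" "\<not> m (Suc i)" for i
  proof (rule ccontr)
    assume m2: "\<not> m (Suc (Suc i))"
    show False
      using y_Suc(1)[OF m(1)] T_Suc(1)[OF m(1)] y_Suc(2)[OF m(2)] T_Suc(2)[OF m(2)] y_Suc(2)[OF m2] T_Suc(2)[OF m2] x_Suc[of i] x_Suc[of "Suc i"]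
        x_Suc[of "Suc (Suc i)"] b(1)[of i] b(2)[of "Suc (Suc (Suc i))"] pos(1)[of i] pos(2)[of i] by linarith
  qed
  have n2: "m (Suc (Suc i))" if m: "\<not> m i" "m (Suc i)" for i
  proof (rule ccontr)
    assume m2: "\<not> m (Suc (Suc i))"
    show False
      using y_Suc(2)[OF m(1)] T_Suc(2)[OF m(1)] y_Suc(1)[OF m(2)] T_Suc(1)[OF m(2)] y_Suc(2)[OF m2] T_Suc(2)[OF m2] x_Suc[of i] x_Suc[of "Suc i"]
        x_Suc[of "Suc (Suc i)"] b(1)[of i] b(2)[of i] b(2)[of "Suc i"] b(1)[of "Suc (Suc i)"] b(2)[of "Suc (Suc (Suc i))"] pos(1)[of i] pos(2)[of i] T(1)[of i] T(2)[of i]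
      by linarith
  qed
  have n3: "\<not> m (i + 3)" if m: "m i" "m (i + 1)" "m (i + 2)" for i
  proof
    assume m3: "m (i + 3)"
    show False
      using y_Suc(1)[OF m(1)] T_Suc(1)[OF m(1)] y_Suc(1)[OF m(2)] T_Suc(1)[OF m(2)] y_Suc(1)[OF m(3)] T_Suc(1)[OF m(3)] y_Suc(1)[OF m3] T_Suc(1)[OF m3] x_Suc[of i] x_Suc[of "i + 1"]
        x_Suc[of "i + 2"] x_Suc[of "i + 3"] b(1)[of i] b(2)[of i] b(1)[of "i + 1"] b(2)[of "i + 1"] b(1)[of "i + 2"] b(2)[of "i + 2"]
        b(1)[of "i + 3"] b(2)[of "i + 3"] b(1)[of "i + 4"] b(2)[of "i + 4"] pos(1)[of i] pos(2)[of i] T(1)[of i] T(2)[of i] unfolding suc[of i] by linarith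
  qed
  have n4: "m (i + 4)" if m: "m i" "\<not> m (i + 1)" "m (i + 2)" "m (i + 3)" for i
  proof (rule ccontr)
    assume m4: "\<not> m (i + 4)"
    show False
      using y_Suc(1)[OF m(1)] T_Suc(1)[OF m(1)] y_Suc(2)[OF m(2)] T_Suc(2)[OF m(2)] y_Suc(1)[OF m(3)] T_Suc(1)[OF m(3)] y_Suc(1)[OF m(4)] T_Suc(1)[OF m(4)] y_Suc(2)[OF m4] T_Suc(2)[OF m4]
        x_Suc[of i] x_Suc[of "i + 1"] x_Suc[of "i + 2"] x_Suc[of "i + 3"] x_Suc[of "i + 4"]
        b(1)[of i] b(2)[of i] b(1)[of "i + 1"] b(2)[of "i + 1"] b(1)[of "i + 2"] b(2)[of "i + 2"] b(1)[of "i + 3"] b(2)[of "i + 3"] b(1)[of "i + 4"] b(2)[of "i + 4"] b(1)[of "i + 5"] b(2)[of "i + 5"] pos(1)[of i] pos(2)[of i] T(1)[of i] T(2)[of i]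
      unfolding suc[of i] by linarith
  qed
  \<comment> \<open>Without any step of kind \<open>m\<close>, \<open>x\<close> would grow linearly
    while \<open>T\<close> stays constant, against the second bound.\<close>
  have "\<exists>i. m i"
  proof (rule ccontr)
    assume "\<nexists>i. m i"
    then have *: "x i = x 0 + real i * y 0 \<and> y i = y 0 \<and> T i = T 0" for i
      by (induction i) (use y_Suc(2) T_Suc(2) x_Suc in \<open>auto simp: algebra_simps\<close>)
    obtain i :: nat where "real i > 151 * T 0 / (100 * y 0)" using reals_Archimedean2 by blast
    then have "100 * (real i * y 0) > 151 * T 0" using pos(2)[of 0] by (simp add: field_simps)
    then show False using b(2)[of i] *[of i] pos(1)[of 0] pos(2)[of 0] by simp
  qed
  then obtain i where i: "m i" by blast
  have "\<exists>k. m k \<and> \<not> m (k + 1)"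
    using n3[of i] i by (auto simp: numeral_eq_Suc)
  then obtain k where k: "m k" "\<not> m (k + 1)" by blast
  \<comment> \<open>After a change from \<open>m\<close> to its negation come three steps with
    \<open>m\<close> and one without, so the change recurs four steps later.\<close>
  have P: "m (j + 2) \<and> m (j + 3) \<and> m (j + 4) \<and> \<not> m (j + 5)" if "m j" "\<not> m (j + 1)" for j
    using n1[of j] n2[of "j + 1"] n3[of "j + 2"] n4[of j] that by (auto simp: numeral_eq_Suc)
  have Q: "m (k + 4 * i) \<and> \<not> m (k + 4 * i + 1)" for i
  proof (induction i)
    case (Suc i)
    then show ?case using P[of "k + 4 * i"] by (auto simp: numeral_eq_Suc)
  qed (use k in auto)
  show False
  proof (rule quadratic_orbit_bound[OF s])
    fix i
    \<comment> \<open>Each period is read from its step without \<open>m\<close>; composing it with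
      the three steps with \<open>m\<close> gives the required coefficients.\<close>
    let ?j = "k + 4 * i + 1"
    show "0 < x ?j" "0 < y ?j" "T ?j \<le> s * x ?j" using pos bound by auto
    have e: "k + 4 * Suc i + 1 = Suc (Suc (Suc (Suc ?j)))" by simp
    have m: "\<not> m ?j" "m (Suc ?j)" "m (Suc (Suc ?j))" "m (Suc (Suc (Suc ?j)))"
      using Q[of i] P[of "k + 4 * i"] by (auto simp: numeral_eq_Suc)
    note st' = y_Suc(2)[OF m(1)] T_Suc(2)[OF m(1)] y_Suc(1)[OF m(2)] T_Suc(1)[OF m(2)] y_Suc(1)[OF m(3)] T_Suc(1)[OF m(3)] y_Suc(1)[OF m(4)] T_Suc(1)[OF m(4)]
      x_Suc[of ?j] x_Suc[of "Suc ?j"] x_Suc[of "Suc (Suc ?j)"] x_Suc[of "Suc (Suc (Suc ?j))"]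
    show "x (k + 4 * Suc i + 1) = 3 * x ?j + 5 * y ?j"
      "y (k + 4 * Suc i + 1) = 2 * x ?j + 3 * y ?j"
      "T (k + 4 * Suc i + 1) = T ?j + 4 * x ?j + 6 * y ?j"
      unfolding e using st' by linarith+
  qed
qed

text \<open>\<open>R\<close> forgets the words and keeps only lengths, with a choice of steps and an
  additive error \<open>K\<close>. Once the lengths are large, a slightly larger slope
  \<open>s'\<close> absorbs \<open>K\<close>, and the step to \<open>(x, x + y, c)\<close> soon
  becomes impossible, which leaves the situation of \<open>balanced_orbit_bound\<close>.\<close>

lemma no_level_orbit:
  fixes R :: "nat \<Rightarrow> nat \<Rightarrow> nat \<Rightarrow> bool" and s K :: real
  assumes s: "1 \<le> s" "s < 2/3 + 4/15 * sqrt 10" and K: "0 \<le> K"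
    and start: "R x0 y0 c0"
    and dom: "\<And>x y c. R x y c \<Longrightarrow> 0 < x \<and> 0 < y \<and> c \<le> x"
    and step: "\<And>x y c. R x y c \<Longrightarrow>
      real (x + y + c) \<le> s * x + K \<and> R x (x + y) c \<or>
      real (y + c) \<le> s * x + K \<and> real (x + y) \<le> s * real (y + c) + K
        \<and> (R (x + y) x (c + y) \<or> R (x + y) y c)"
  shows False
proof -
  define P :: "nat \<times> nat \<times> nat \<Rightarrow> bool" where "P = (\<lambda>(x, y, c). R x y c)"
  define A :: "nat \<times> nat \<times> nat \<Rightarrow> nat \<times> nat \<times> nat \<Rightarrow> bool" where
    "A = (\<lambda>(x, y, c) v. real (x + y + c) \<le> s * x + K \<and> v = (x, x + y, c))"
  define C :: "nat \<times> nat \<times> nat \<Rightarrow> bool" where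
    "C = (\<lambda>(x, y, c). real (y + c) \<le> s * x + K \<and> real (x + y) \<le> s * real (y + c) + K)"
  define G :: "nat \<times> nat \<times> nat \<Rightarrow> nat \<times> nat \<times> nat" where
    "G = (\<lambda>(x, y, c). (x + y, x, c + y))"
  define H :: "nat \<times> nat \<times> nat \<Rightarrow> nat \<times> nat \<times> nat" where
    "H = (\<lambda>(x, y, c). (x + y, y, c))"
  have "\<exists>f. \<forall>n. P (f n) \<and> (A (f n) (f (Suc n)) \<or> C (f n) \<and> (f (Suc n) = G (f n) \<or> f (Suc n) = H (f n)))"
  proof (rule dependent_nat_choice)
    show "\<exists>v. P v" using start by (auto simp: P_def)
    show "\<exists>v. P v \<and> (A u v \<or> C u \<and> (v = G u \<or> v = H u))" if "P u" for u n
      using that by (cases u) (use step in \<open>fastforce simp: P_def A_def C_def G_def H_def\<close>)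
  qed
  then obtain f where f: "\<And>n. P (f n)"
    "\<And>n. A (f n) (f (Suc n)) \<or> C (f n) \<and> (f (Suc n) = G (f n) \<or> f (Suc n) = H (f n))" by blast
  define x where "x n = fst (f n)" for n
  define y where "y n = fst (snd (f n))" for n
  define c where "c n = snd (snd (f n))" for n
  have fn: "f n = (x n, y n, c n)" for n by (simp add: x_def y_def c_def)
  have dom': "0 < x n" "0 < y n" "c n \<le> x n" for n
    using dom[of "x n" "y n" "c n"] f(1)[of n] by (auto simp: fn P_def)
  have mv: "real (x n + y n + c n) \<le> s * x n + K \<and> x (Suc n) = x n \<and> y (Suc n) = x n + y n \<and> c (Suc n) = c n \<or>
      real (y n + c n) \<le> s * x n + K \<and> real (x n + y n) \<le> s * real (y n + c n) + K \<and> x (Suc n) = x n + y n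
        \<and> (y (Suc n) = x n \<and> c (Suc n) = c n + y n \<or> y (Suc n) = y n \<and> c (Suc n) = c n)" for n
    using f(2)[of n] unfolding fn by (auto simp: A_def C_def G_def H_def)
  have grow: "n \<le> x n + y n" for n
  proof (induction n)
    case (Suc n)
    then show ?case using mv[of n] dom'[of n] by auto
  qed simp
  define s' where "s' = (s + (2/3 + 4/15 * sqrt 10)) / 2"
  define e where "e = s' - s"
  have s': "s < s'" "s' < 2/3 + 4/15 * sqrt 10" using s by (auto simp: s'_def)
  then have e: "e > 0" by (simp add: e_def)
  have s2: "s' < 151/100" using s'(2) sigma_less by linarith
  \<comment> \<open>Since n is at most x + y and the slope is below 2, the bounds of a step give n
    <= 3 v + K for v = x, and also for v = T in the last two kinds of step. Beyond \<open>n0\<close>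
    this yields K <= e v.\<close>
  obtain n0 :: nat where n0: "real n0 > 3 * (K / e) + K" using reals_Archimedean2 by blast
  have large: "K \<le> e * v" if "real n0 \<le> 3 * v + K" for v
  proof -
    have "K / e \<le> v" using that n0 by linarith
    then show ?thesis using e by (simp add: field_simps)
  qed
  define T where "T n = real (y n) + real (c n)" for n
  have mv': "real (x n) + T n \<le> s' * x n \<and> x (Suc n) = x n \<and> T (Suc n) = T n + x n \<or>
      T n \<le> s' * x n \<and> real (x n) + real (y n) \<le> s' * T n \<and> x (Suc n) = x n + y n
        \<and> (y (Suc n) = x n \<and> T (Suc n) = T n + x n \<or> y (Suc n) = y n \<and> T (Suc n) = T n)"
    if "n \<ge> n0" for n
  proof -
    have g: "real n0 \<le> real (x n) + real (y n)" using grow[of n] that by linarith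
    have sx: "s * real (x n) \<le> 2 * real (x n)" using s s2 s' by (intro mult_right_mono) auto
    have sT: "s * T n \<le> 2 * T n" using s s2 s' by (intro mult_right_mono) (auto simp: T_def)
    have split: "s' * v = s * v + e * v" for v by (simp add: e_def algebra_simps)
    from mv[of n] show ?thesis
    proof (elim disjE conjE, goal_cases)
      case 1
      then have "K \<le> e * x n" using g sx by (intro large) simp
      then show ?case using 1 unfolding split by (auto simp: T_def)
    next
      case 2
      then have "K \<le> e * x n" "K \<le> e * T n" using g sx sT by (intro large; simp add: T_def)+
      then show ?case using 2 unfolding split by (auto simp: T_def)
    next
      case 3
      then have "K \<le> e * x n" "K \<le> e * T n" using g sx sT by (intro large; simp add: T_def)+
      then show ?case using 3 unfolding split by (auto simp: T_def)
    qed
  qed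
  have T: "real (y n) \<le> T n" "T n \<le> real (x n) + real (y n)" for n
    using dom'(3)[of n] by (auto simp: T_def)
  have bd: "s' * real (x n) \<le> 151/100 * real (x n)" "s' * T n \<le> 151/100 * T n" for n
    using s2 by (intro mult_right_mono; simp add: T_def)+
  \<comment> \<open>The bound of the first kind of step would mean T <= 0.51 x, but after a step of
    any kind T is larger than that.\<close>
  have noA: "\<not> real (x (Suc n)) + T (Suc n) \<le> s' * x (Suc n)" if "n \<ge> n0" for n
  proof
    assume "real (x (Suc n)) + T (Suc n) \<le> s' * x (Suc n)"
    then have h: "100 * T (Suc n) \<le> 51 * real (x (Suc n))" using bd(1)[of "Suc n"] by linarith
    have p: "0 < real (x n)" "0 < real (y n)" "0 < T n" using dom'(1,2)[of n] T(1)[of n] by simp_all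
    from mv'[OF that] show False
    proof (elim disjE conjE, goal_cases)
      case 1
      then show ?case using h p by simp
    next
      case 2
      then have "100 * real (x n) + 100 * real (y n) \<le> 151 * T n" using bd(2)[of n] by linarith
      moreover have "100 * T n + 100 * real (x n) \<le> 51 * real (x n) + 51 * real (y n)" using 2 h by simp
      ultimately show ?case using p by linarith
    next
      case 3
      then have "100 * real (x n) + 100 * real (y n) \<le> 151 * T n" using bd(2)[of n] by linarith
      moreover have "100 * T n \<le> 51 * real (x n) + 51 * real (y n)" using 3 h by simp
      ultimately show ?case using p by linarith
    qed
  qed
  have mv2: "T (n0 + 1 + n) \<le> s' * x (n0 + 1 + n) \<and> real (x (n0 + 1 + n)) + real (y (n0 + 1 + n)) \<le> s' * T (n0 + 1 + n) \<and>
      x (n0 + 1 + Suc n) = x (n0 + 1 + n) + y (n0 + 1 + n)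
        \<and> (y (n0 + 1 + Suc n) = x (n0 + 1 + n) \<and> T (n0 + 1 + Suc n) = T (n0 + 1 + n) + x (n0 + 1 + n) \<or>
           y (n0 + 1 + Suc n) = y (n0 + 1 + n) \<and> T (n0 + 1 + Suc n) = T (n0 + 1 + n))" for n
    using mv'[of "n0 + 1 + n"] noA[of "n0 + n"] by auto
  show False
  proof (rule balanced_orbit_bound[OF s'(2), where x = "\<lambda>n. real (x (n0 + 1 + n))" and y = "\<lambda>n. real (y (n0 + 1 + n))"
        and T = "\<lambda>n. T (n0 + 1 + n)"
        and m = "\<lambda>n. y (n0 + 1 + Suc n) = x (n0 + 1 + n) \<and> T (n0 + 1 + Suc n) = T (n0 + 1 + n) + x (n0 + 1 + n)"])
    fix i
    show "0 < real (x (n0 + 1 + i))" "0 < real (y (n0 + 1 + i))" using dom' by auto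
    show "real (y (n0 + 1 + i)) \<le> T (n0 + 1 + i)" "T (n0 + 1 + i) \<le> real (x (n0 + 1 + i)) + real (y (n0 + 1 + i))"
      using T by auto
    show "T (n0 + 1 + i) \<le> s' * real (x (n0 + 1 + i))"
      "real (x (n0 + 1 + i)) + real (y (n0 + 1 + i)) \<le> s' * T (n0 + 1 + i)"
      "real (x (n0 + 1 + Suc i)) = real (x (n0 + 1 + i)) + real (y (n0 + 1 + i))"
      using mv2[of i] by (blast, blast, simp)
  next
    fix i
    assume "\<not> (y (n0 + 1 + Suc i) = x (n0 + 1 + i) \<and> T (n0 + 1 + Suc i) = T (n0 + 1 + i) + x (n0 + 1 + i))"
    then show "real (y (n0 + 1 + Suc i)) = real (y (n0 + 1 + i))" "T (n0 + 1 + Suc i) = T (n0 + 1 + i)"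
      using mv2[of i] by (metis, metis)
  qed simp_all
qed

section \<open>Block decompositions\<close>

text \<open>The word \<open>z\<close> is cut at the positions in \<open>B\<close>, and \<open>t p\<close> tells whether \<open>X\<close> or \<open>Y\<close>
  starts at the cut \<open>p\<close>. Every sequence of blocks starts with \<open>w\<close>. A level also records that the
  first cut is at \<open>c\<close> and that the part of \<open>z\<close> before it is a suffix of \<open>X\<close>.\<close>

definition blocks :: "(nat \<Rightarrow> 'a) \<Rightarrow> 'a list \<Rightarrow> 'a list \<Rightarrow> 'a list \<Rightarrow> nat set \<Rightarrow> (nat \<Rightarrow> bool) \<Rightarrow> bool" where
  "blocks z w X Y B t \<longleftrightarrow> X \<noteq> [] \<and> Y \<noteq> [] \<and> prefix w (X @ w) \<and> prefix w (Y @ w) \<and>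
     (\<forall>p\<in>B. t p \<longrightarrow> factor z p (length X) = X \<and> p + length X \<in> B) \<and>
     (\<forall>p\<in>B. \<not> t p \<longrightarrow> factor z p (length Y) = Y \<and> p + length Y \<in> B)"

definition level :: "(nat \<Rightarrow> 'a) \<Rightarrow> 'a list \<Rightarrow> 'a list \<Rightarrow> 'a list \<Rightarrow> nat \<Rightarrow> nat set \<Rightarrow> (nat \<Rightarrow> bool) \<Rightarrow> bool" where
  "level z w X Y c B t \<longleftrightarrow> blocks z w X Y B t \<and> 0 < c \<and> c \<le> length X \<and>
     factor z 0 c = drop (length X - c) X \<and> c \<in> B"

lemma blocksD:
  assumes "blocks z w X Y B t"
  shows "X \<noteq> []" "Y \<noteq> []" "prefix w (X @ w)" "prefix w (Y @ w)"
    "\<And>p. p \<in> B \<Longrightarrow> t p \<Longrightarrow> factor z p (length X) = X" "\<And>p. p \<in> B \<Longrightarrow> t p \<Longrightarrow> p + length X \<in> B"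
    "\<And>p. p \<in> B \<Longrightarrow> \<not> t p \<Longrightarrow> factor z p (length Y) = Y" "\<And>p. p \<in> B \<Longrightarrow> \<not> t p \<Longrightarrow> p + length Y \<in> B"
  using assms by (auto simp: blocks_def)

lemma levelD:
  assumes "level z w X Y c B t"
  shows "blocks z w X Y B t" "0 < c" "c \<le> length X" "factor z 0 c = drop (length X - c) X" "c \<in> B"
  using assms by (auto simp: level_def)

lemma blocks_swap: "blocks z w X Y B t \<Longrightarrow> blocks z w Y X B (\<lambda>p. \<not> t p)"
  by (auto simp: blocks_def)

text \<open>Whatever blocks follow a cut, \<open>w\<close> is read there: a prefix of
  \<open>w\<close> either ends inside the first block or continues behind it with a shorter prefix
  of \<open>w\<close>, whence the induction on its length.\<close>

lemma blocks_factor_w: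
  assumes bl: "blocks z w X Y B t" and "p \<in> B"
  shows "factor z p (length w) = w"
proof -
  note b = blocksD[OF bl]
  have main: "factor z p m = take m w"
    if v: "v \<noteq> []" "prefix w (v @ w)" "factor z p (length v) = v" "m \<le> length w"
      and IH: "m > length v \<Longrightarrow> factor z (p + length v) (m - length v) = take (m - length v) w" for v p m
  proof -
    have tw: "take m w = take m (v @ w)"
      using v(2,4) by (auto simp: prefix_def) (metis append_take_drop_id take_append diff_is_0_eq take_0 append_Nil2)
    show ?thesis
    proof (cases "m \<le> length v")
      case True
      then have "factor z p m = take m (factor z p (length v))"
        using take_drop_factor[of 0 m "length v" z p] by simp
      then show ?thesis using tw v(3) True by simp
    next
      case False
      then have "factor z p m = factor z p (length v) @ factor z (p + length v) (m - length v)"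
        using factor_add[of z p "length v" "m - length v"] by simp
      then show ?thesis using tw v(3) IH False by simp
    qed
  qed
  have "\<forall>p\<in>B. m \<le> length w \<longrightarrow> factor z p m = take m w" for m
  proof (induction m rule: less_induct)
    case (less m)
    show ?case
    proof (intro ballI impI)
      fix p assume p: "p \<in> B" "m \<le> length w"
      show "factor z p m = take m w"
      proof (cases "t p")
        case True
        show ?thesis by (rule main[of X]) (use True p b less.IH[of "m - length X"] in auto)
      next
        case False
        show ?thesis by (rule main[of Y]) (use False p b less.IH[of "m - length Y"] in auto)
      qed
    qed
  qed
  then show ?thesis using assms(2) by (metis order_refl take_all)
qed

lemma blocks_factor_block:
  assumes bl: "blocks z w X Y B t" and p: "p \<in> B"
  shows "t p \<Longrightarrow> factor z p (length X + length w) = X @ w"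
    and "\<not> t p \<Longrightarrow> factor z p (length Y + length w) = Y @ w"
  using blocksD[OF bl] blocks_factor_w[OF bl] p by (simp_all add: factor_add)

lemma level_factor_start:
  assumes lv: "level z w X Y c B t"
  shows "factor z 0 (c + length w) = drop (length X - c) (X @ w)"
  using levelD[OF lv] blocks_factor_w[OF levelD(1)[OF lv], of c] by (simp add: factor_add)

text \<open>The part before the first cut is a suffix of \<open>X\<close>, so windows starting there
  lie in \<open>X @ w\<close>; any other window starts in the block at the last cut not after
  it.\<close>

lemma card_factors_level:
  assumes lv: "level z w X Y c B t"
  shows "card (factors z (length w)) \<le> length X + length Y - 1"
proof (rule card_factors_if_covered)
  note l = levelD[OF lv]
  note b = blocksD[OF l(1)]
  show "X \<noteq> []" "Y \<noteq> []" "prefix w (X @ w)" "prefix w (Y @ w)" by (fact b)+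
  fix p
  show "\<exists>v\<in>{X, Y}. \<exists>k<length v. factor z p (length w) = take (length w) (drop k (v @ w))"
  proof (cases "p < c")
    case True
    have "factor z p (length w) = take (length w) (drop p (factor z 0 (c + length w)))"
      using take_drop_factor[of p "length w" "c + length w" z 0] True by simp
    also have "\<dots> = take (length w) (drop (p + (length X - c)) (X @ w))"
      unfolding level_factor_start[OF lv] drop_drop ..
    finally show ?thesis using True l(3) by (intro bexI[of _ X] exI[of _ "p + (length X - c)"]) auto
  next
    case False
    define q where "q = Max {q \<in> B. q \<le> p}"
    have fin: "finite {q \<in> B. q \<le> p}" by (rule finite_subset[of _ "{..p}"]) auto
    have "q \<in> {q \<in> B. q \<le> p}" unfolding q_def using fin False l(5) by (intro Max_in) auto
    then have q: "q \<in> B" "q \<le> p" by auto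
    have q_max: "r \<le> q" if "r \<in> B" "r \<le> p" for r unfolding q_def using fin that by (intro Max_ge) auto
    define v where "v = (if t q then X else Y)"
    have v: "v \<in> {X, Y}" "factor z q (length v + length w) = v @ w" "q + length v \<in> B" "v \<noteq> []"
      using blocks_factor_block[OF l(1) q(1)] b q(1) by (auto simp: v_def)
    have "p < q + length v" using q_max[OF v(3)] v(4) by (cases "q + length v \<le> p") auto
    then have "p - q < length v" using q(2) by simp
    moreover have "factor z p (length w) = take (length w) (drop (p - q) (v @ w))"
      unfolding v(2)[symmetric] using take_drop_factor[of "p - q" "length w" "length v + length w" z q] q(2) calculation
      by simp
    ultimately show ?thesis using v(1) by blast
  qed
qed

section \<open>Lengthening the common prefix and excluding one of the squares\<close>

lemma level_from_zero:
  assumes bl: "blocks z w X Y B t" and "0 \<in> B"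
  shows "\<exists>X' Y' c t'. level z w X' Y' c B t' \<and> length X' + length Y' = length X + length Y"
proof (cases "t 0")
  case True
  then have "level z w X Y (length X) B t"
    using blocksD[OF bl] bl assms(2) blocksD(6)[OF bl, of 0] by (simp add: level_def)
  then show ?thesis by blast
next
  case False
  then have "level z w Y X (length Y) B (\<lambda>p. \<not> t p)"
    using blocksD[OF bl] blocks_swap[OF bl] assms(2) blocksD(8)[OF bl, of 0] by (simp add: level_def)
  then show ?thesis by (metis add.commute)
qed

text \<open>A last letter common to both blocks can be moved to their front: the cuts move one place
  to the left and \<open>w\<close> gains \<open>e\<close> in front. The block lengths keep their
  sum, so the excess |X| + |Y| - |w| drops by one.\<close>

lemma level_rotate:
  assumes lv: "level z w (X @ [e]) (Y @ [e]) c B t"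
  shows "\<exists>X' Y' c' B' t'. level z (e # w) X' Y' c' B' t' \<and> length X' + length Y' = Suc (length X) + Suc (length Y)"
proof -
  note l = levelD[OF lv]
  note b = blocksD[OF l(1)]
  \<comment> \<open>The definition of \<open>blocks\<close> does not restrict what precedes a cut,
    so the letter \<open>e\<close> is demanded explicitly.\<close>
  define B' where "B' = {p. Suc p \<in> B \<and> z p = e}"
  have rot: "factor z p (Suc (length V)) = e # V \<and> p + Suc (length V) \<in> B'"
    if "factor z (Suc p) (Suc (length V)) = V @ [e]" "Suc p + Suc (length V) \<in> B" "z p = e" for p V
  proof -
    have "factor z (Suc p) (length V) = V" "z (Suc p + length V) = e"
      using that(1) unfolding factor_Suc by auto
    then show ?thesis using that(2,3) by (simp add: B'_def factor_Suc_Cons)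
  qed
  have bl: "blocks z (e # w) (e # X) (e # Y) B' (\<lambda>p. t (Suc p))"
    unfolding blocks_def
  proof (intro conjI ballI impI)
    show "prefix (e # w) ((e # X) @ e # w)" "prefix (e # w) ((e # Y) @ e # w)" using b(3,4) by auto
  next
    fix p assume p: "p \<in> B'" "t (Suc p)"
    then show "factor z p (length (e # X)) = e # X" "p + length (e # X) \<in> B'"
      using rot[of p X] b(5)[of "Suc p"] b(6)[of "Suc p"] by (auto simp: B'_def)
  next
    fix p assume p: "p \<in> B'" "\<not> t (Suc p)"
    then show "factor z p (length (e # Y)) = e # Y" "p + length (e # Y) \<in> B'"
      using rot[of p Y] b(7)[of "Suc p"] b(8)[of "Suc p"] by (auto simp: B'_def)
  qed auto
  obtain c1 where c1: "c = Suc c1" using l(2) by (cases c) auto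
  have S: "factor z 0 c1 = drop (length X - c1) X" "z c1 = e"
    using l(3,4) unfolding c1 by (auto simp: factor_Suc)
  have "c1 \<in> B'" using l(5) S by (simp add: B'_def c1)
  show ?thesis
  proof (cases "c1 = 0")
    \<comment> \<open>The part before the first cut would be empty, so the first block takes over
      its role.\<close>
    case True
    then have "0 \<in> B'" using \<open>c1 \<in> B'\<close> by simp
    from level_from_zero[OF bl this] show ?thesis unfolding length_Cons by blast
  next
    case False
    then have "level z (e # w) (e # X) (e # Y) c1 B' (\<lambda>p. t (Suc p))"
      using bl \<open>c1 \<in> B'\<close> S l(3) by (auto simp: level_def c1 Suc_diff_le)
    then show ?thesis by (metis length_Cons)
  qed
qed

text \<open>A letter that follows \<open>w\<close> in both products belongs to the common prefix;
  appending it lowers the excess |X| + |Y| - |w| by one.\<close>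

lemma level_extend:
  assumes "level z w X Y c B t" "prefix (w @ [f]) (X @ w)" "prefix (w @ [f]) (Y @ w)"
  shows "level z (w @ [f]) X Y c B t"
proof -
  have "prefix (w @ [f]) (V @ w @ [f])" if "prefix (w @ [f]) (V @ w)" for V
    using that prefix_order.trans[OF that, of "V @ w @ [f]"] by simp
  then show ?thesis using assms by (auto simp: level_def blocks_def)
qed

lemma periodic_if_repeated_block:
  assumes "v \<noteq> []" "a \<in> A"
    and A: "\<And>p. p \<in> A \<Longrightarrow> factor z p (length v) = v" "\<And>p. p \<in> A \<Longrightarrow> p + length v \<in> A"
  shows "eventually_periodic z"
proof -
  let ?L = "length v"
  have L: "?L > 0" using assms(1) by simp
  have inA: "a + k * ?L \<in> A" for k
  proof (induction k)
    case (Suc k)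
    then show ?case using A(2)[OF Suc] by (simp add: add_ac)
  qed (use assms(2) in simp)
  have zv: "z (a + k * ?L + r) = v ! r" if "r < ?L" for k r
    using A(1)[OF inA[of k]] that by (metis nth_factor)
  have "z (i + ?L) = z i" if "i \<ge> a" for i
  proof -
    define k r where "k = (i - a) div ?L" and "r = (i - a) mod ?L"
    have "r < ?L" "i = a + k * ?L + r" using L that by (simp_all add: k_def r_def)
    then show ?thesis using zv[of r k] zv[of r "Suc k"] by (simp add: add_ac)
  qed
  then show ?thesis using L unfolding eventually_periodic_def by blast
qed

lemma prefix_next_letter:
  assumes "prefix w (V @ w)" "V \<noteq> []"
  obtains f where "prefix (w @ [f]) (V @ w)"
proof -
  obtain u where u: "V @ w = w @ u" using assms(1) by (auto simp: prefix_def)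
  then have "length V = length u" by (metis add.commute add_left_cancel length_append)
  then obtain f u' where "u = f # u'" using assms(2) by (cases u) auto
  then show thesis using u that[of f] by simp
qed

text \<open>By minimality of \<open>length X + length Y - length w\<close> the last letters \<open>e\<close>, \<open>e'\<close> of \<open>X\<close>, \<open>Y\<close> differ, and so
  do the letters following \<open>w\<close> in \<open>X @ w\<close> and \<open>Y @ w\<close>. If both squares occurred, then both \<open>e # w\<close>
  and \<open>e' # w\<close> would be right special.\<close>

lemma level_not_both_squares:
  assumes lv: "level z w X Y c B t" and np: "\<not> eventually_periodic z"
    and urs: "unique_right_special z (Suc (length w))"
    and min: "\<And>w' X' Y' c' B' t'. level z w' X' Y' c' B' t' \<Longrightarrow> length w \<le> length w' \<Longrightarrow>
      length X + length Y + length w' \<le> length X' + length Y' + length w"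
  shows "\<not> t c \<and> (\<forall>p\<in>B. t p \<longrightarrow> \<not> t (p + length X)) \<or> (\<forall>p\<in>B. \<not> t p \<longrightarrow> t (p + length Y))"
proof (rule ccontr)
  assume contra: "\<not> ?thesis"
  note l = levelD[OF lv]
  note b = blocksD[OF l(1)]
  let ?n = "length w"
  obtain f where f: "prefix (w @ [f]) (X @ w)" using prefix_next_letter[OF b(3,1)] .
  obtain f' where f': "prefix (w @ [f']) (Y @ w)" using prefix_next_letter[OF b(4,2)] .
  obtain X1 e where X: "X = X1 @ [e]" using b(1) by (metis rev_exhaust)
  obtain Y1 e' where Y: "Y = Y1 @ [e']" using b(2) by (metis rev_exhaust)
  \<comment> \<open>A common letter after \<open>w\<close>, or a common last letter of the blocks,
    would give a longer common prefix with the same total block length, against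
    \<open>min\<close>.\<close>
  have "f \<noteq> f'"
  proof
    assume "f = f'"
    then have "level z (w @ [f]) X Y c B t" using level_extend[OF lv f] f' by simp
    from min[OF this] show False by simp
  qed
  have "e \<noteq> e'"
  proof
    assume "e = e'"
    then obtain X' Y' c' B' t' where "level z (e # w) X' Y' c' B' t'" "length X' + length Y' = Suc (length X1) + Suc (length Y1)"
      using level_rotate[of z w X1 e Y1 c B t] lv X Y by auto
    with min[OF this(1)] show False by (simp add: X Y)
  qed
  have nth_w: "u ! ?n = g" if "prefix (w @ [g]) u" for u g
    using that by (auto simp: prefix_def nth_append)
  have next_f: "z (p + ?n) = (if t p then f else f')" if "p \<in> B" for p
    using blocks_factor_block[OF l(1) that] nth_w[OF f] nth_w[OF f'] b(1,2)
    by (auto simp: factor_eq_iff)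
  have prev: "z (p + length X1) = e" if "p \<in> B" "t p" for p
    using b(5)[OF that] by (auto simp: factor_eq_iff X)
  have prev': "z (p + length Y1) = e'" if "p \<in> B" "\<not> t p" for p
    using b(7)[OF that] by (auto simp: factor_eq_iff Y)
  obtain c1 where c1: "c = Suc c1" using l(2) by (cases c) auto
  have zc: "z c1 = e" using l(3,4) unfolding c1 X by (auto simp: factor_Suc)
  have sX: "Suc (p + length X1) = p + length X" and sY: "Suc (p + length Y1) = p + length Y" for p
    by (simp_all add: X Y)
  have word: "factor z q (Suc ?n) = z q # w \<and> z (q + Suc ?n) = (if t (Suc q) then f else f')" if "Suc q \<in> B" for q
    using blocks_factor_w[OF l(1) that] next_f[OF that] by (simp add: factor_Suc_Cons)
  \<comment> \<open>All four combinations of a letter \<open>e\<close> or \<open>e'\<close> before a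
    cut with a block after it are found. The part before \<open>c\<close> ends in \<open>e\<close>,
    so \<open>t c\<close> serves as an occurrence of the square of \<open>X\<close>.\<close>
  have XX: "\<exists>q. Suc q \<in> B \<and> z q = e \<and> t (Suc q)"
  proof (cases "t c")
    case True
    then show ?thesis using zc l(5) c1 by blast
  next
    case False
    then obtain p where "p \<in> B" "t p" "t (p + length X)" using contra by blast
    then show ?thesis using prev b(6) sX by metis
  qed
  have YY: "\<exists>q. Suc q \<in> B \<and> z q = e' \<and> \<not> t (Suc q)"
  proof -
    obtain p where "p \<in> B" "\<not> t p" "\<not> t (p + length Y)" using contra by blast
    then show ?thesis using prev' b(8) sY by metis
  qed
  \<comment> \<open>If every cut preceded by \<open>e\<close> started a block \<open>X\<close>, then
    only \<open>X\<close> would be read from \<open>c\<close> on.\<close>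
  have XY: "\<exists>q. Suc q \<in> B \<and> z q = e \<and> \<not> t (Suc q)"
  proof (rule ccontr)
    assume no: "\<not> ?thesis"
    have "eventually_periodic z"
    proof (rule periodic_if_repeated_block[of X c "{p \<in> B. t p}"])
      show "c \<in> {p \<in> B. t p}" using no zc l(5) c1 by blast
      show "p + length X \<in> {p \<in> B. t p}" if "p \<in> {p \<in> B. t p}" for p
        using that no prev[of p] b(6)[of p] sX[of p] by (metis (mono_tags, lifting) mem_Collect_eq)
    qed (use b in auto)
    then show False using np by blast
  qed
  have YX: "\<exists>q. Suc q \<in> B \<and> z q = e' \<and> t (Suc q)"
  proof (rule ccontr)
    assume no: "\<not> ?thesis"
    obtain a where a: "a \<in> B" "\<not> t a" using XY by blast
    have "eventually_periodic z"
    proof (rule periodic_if_repeated_block[of Y a "{p \<in> B. \<not> t p}"])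
      show "p + length Y \<in> {p \<in> B. \<not> t p}" if "p \<in> {p \<in> B. \<not> t p}" for p
        using that no prev'[of p] b(8)[of p] sY[of p] by (metis (mono_tags, lifting) mem_Collect_eq)
    qed (use a b in auto)
    then show False using np by blast
  qed
  from XX obtain q1 where q1: "Suc q1 \<in> B" "z q1 = e" "t (Suc q1)" by blast
  from XY obtain q2 where q2: "Suc q2 \<in> B" "z q2 = e" "\<not> t (Suc q2)" by blast
  from YX obtain q3 where q3: "Suc q3 \<in> B" "z q3 = e'" "t (Suc q3)" by blast
  from YY obtain q4 where q4: "Suc q4 \<in> B" "z q4 = e'" "\<not> t (Suc q4)" by blast
  have "factor z q1 (Suc ?n) = factor z q3 (Suc ?n)"
    by (rule urs[unfolded unique_right_special_def, rule_format, of _ q2 _ q4])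
      (use word[OF q1(1)] word[OF q2(1)] word[OF q3(1)] word[OF q4(1)] q1 q2 q3 q4 \<open>f \<noteq> f'\<close> in simp_all)
  then show False using word[OF q1(1)] word[OF q3(1)] q1 q3 \<open>e \<noteq> e'\<close> by simp
qed

text \<open>Every \<open>Y\<close> is followed by \<open>X\<close>, so from the first
  \<open>X\<close> on the blocks regroup into \<open>X\<close> and \<open>X @ Y\<close>. An initial
  \<open>Y\<close> joins the part before the first cut, which is then a suffix of
  \<open>X @ Y\<close>; hence the exchanged roles in the second case. The excess |X| + |Y| - |w| is
  unchanged.\<close>

lemma level_step_short:
  assumes lv: "level z w X Y c B t" and noYY: "\<And>p. p \<in> B \<Longrightarrow> \<not> t p \<Longrightarrow> t (p + length Y)"
  shows "t c \<Longrightarrow> level z (X @ w) X (X @ Y) c {p \<in> B. t p} (\<lambda>p. t (p + length X))"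
    and "\<not> t c \<Longrightarrow> level z (X @ w) (X @ Y) X (c + length Y) {p \<in> B. t p} (\<lambda>p. \<not> t (p + length X))"
proof -
  note l = levelD[OF lv]
  note b = blocksD[OF l(1)]
  have "prefix w (Y @ X @ w)"
    using prefix_order.trans[OF b(4), of "Y @ X @ w"] b(3) by simp
  then have bl: "blocks z (X @ w) X (X @ Y) {p \<in> B. t p} (\<lambda>p. t (p + length X))"
    unfolding blocks_def using b noYY by (auto simp: factor_add add.assoc[symmetric])
  show "level z (X @ w) X (X @ Y) c {p \<in> B. t p} (\<lambda>p. t (p + length X))" if "t c"
    using that l bl by (simp add: level_def)
  show "level z (X @ w) (X @ Y) X (c + length Y) {p \<in> B. t p} (\<lambda>p. \<not> t (p + length X))" if "\<not> t c"
    using that l b(7,8)[of c] blocks_swap[OF bl] noYY[of c] by (simp add: level_def factor_add)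
qed

text \<open>Every \<open>X\<close> is followed by \<open>Y\<close>, so the blocks regroup into
  \<open>Y @ X\<close> and \<open>Y\<close>. The part before the first cut remains a suffix of the
  longer one, and the excess is again unchanged.\<close>

lemma level_step_long:
  assumes lv: "level z w X Y c B t" and noXX: "\<not> t c" "\<And>p. p \<in> B \<Longrightarrow> t p \<Longrightarrow> \<not> t (p + length X)"
  shows "level z (Y @ w) (Y @ X) Y c {p \<in> B. \<not> t p} (\<lambda>p. t (p + length Y))"
proof -
  note l = levelD[OF lv]
  note b = blocksD[OF l(1)]
  have "prefix w (X @ Y @ w)"
    using prefix_order.trans[OF b(3), of "X @ Y @ w"] b(4) by simp
  then have bl: "blocks z (Y @ w) (Y @ X) Y {p \<in> B. \<not> t p} (\<lambda>p. t (p + length Y))"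
    unfolding blocks_def using b noXX(2) by (auto simp: factor_add add.assoc[symmetric])
  show ?thesis using l bl noXX(1) by (simp add: level_def)
qed

text \<open>The word begins with a suffix of \<open>X\<close> followed by \<open>X @ w\<close>, so
  the corresponding suffix of \<open>X @ w\<close> is read at 0 and again at
  \<open>length X\<close>.\<close>

lemma level_repetition_same:
  assumes lv: "level z w X Y c B t" and "t c"
  shows "factor z 0 (c + length w) = factor z (length X) (c + length w)"
proof -
  note l = levelD[OF lv]
  note b = blocksD[OF l(1)]
  have 1: "factor z c (length X + length w) = X @ w"
    using blocks_factor_block(1)[OF l(1,5)] assms(2) by simp
  have "factor z (length X) (c + length w) = take (c + length w) (drop (length X - c) (factor z c (length X + length w)))"
    using take_drop_factor[of "length X - c" "c + length w" "length X + length w" z c] l(3) by simp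
  also have "\<dots> = drop (length X - c) (X @ w)" unfolding 1 using l(3) by simp
  finally show ?thesis using level_factor_start[OF lv] by simp
qed

text \<open>Being a prefix of \<open>X @ w\<close>, \<open>w\<close> has period |X|, and a suffix of
  \<open>X\<close> put in front keeps this period. No level is assumed because the extremal word
  needs the same fact.\<close>

lemma shift_repetition:
  assumes S: "factor z 0 c = drop (length X - c) X" "c \<le> length X"
    and w: "factor z c (length w) = w" "prefix w (X @ w)"
  shows "factor z 0 (c + length w - length X) = factor z (length X) (c + length w - length X)"
proof (cases "length X \<le> c + length w")
  case True
  let ?m = "c + length w - length X"
  have start: "factor z 0 (c + length w) = drop (length X - c) (X @ w)"
    using S w by (simp add: factor_add)
  have "factor z (length X) ?m = take ?m (drop (length X - c) (factor z c (length w)))"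
    using take_drop_factor[of "length X - c" ?m "length w" z c] S(2) True by simp
  also have "\<dots> = take ?m (drop (length X - c) (take (length w) (X @ w)))"
    unfolding w(1) take_prefix[OF w(2)] ..
  also have "\<dots> = take ?m (drop (length X - c) (X @ w))"
    using True S(2) by (simp only: drop_take take_take) (simp add: min_def)
  also have "\<dots> = factor z 0 ?m"
    unfolding start[symmetric] using take_drop_factor[of 0 ?m "c + length w" z 0] by simp
  finally show ?thesis by simp
qed (simp add: factor_def)

lemma level_repetition_other:
  assumes lv: "level z w X Y c B t" and "\<not> t c"
  shows "factor z c (length w) = factor z (c + length Y) (length w)"
    and "factor z 0 (c + length w - length X) = factor z (length X) (c + length w - length X)"
proof -
  note l = levelD[OF lv]
  note b = blocksD[OF l(1)]
  have w: "factor z c (length w) = w" using blocks_factor_w[OF l(1,5)] .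
  show "factor z c (length w) = factor z (c + length Y) (length w)"
    using w blocks_factor_w[OF l(1) b(8)[OF l(5) assms(2)]] by simp
  show "factor z 0 (c + length w - length X) = factor z (length X) (c + length w - length X)"
    by (rule shift_repetition[OF l(4,3) w b(3)])
qed

text \<open>Minimality of the excess \<open>D\<close> of |X| + |Y| over |w| excludes one square, and
  the steps preserve the excess, so the lengths run through an orbit refuted by
  \<open>no_level_orbit\<close>. In \<open>rep\<close>, \<open>k\<close> accounts for a deleted
  prefix, and repetitions shorter than \<open>M\<close> are not controlled.\<close>

lemma levels_force_repetitions:
  fixes z :: "nat \<Rightarrow> 'a" and s :: real
  assumes fin: "finite (range z)" and np: "\<not> eventually_periodic z"
    and urs: "\<And>n. n \<ge> N \<Longrightarrow> unique_right_special z n"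
    and lv0: "level z w0 X0 Y0 c0 B0 t0" "N \<le> length w0"
    and s: "1 \<le> s" "s < 2/3 + 4/15 * sqrt 10"
    and rep: "\<And>i j n. i < j \<Longrightarrow> M \<le> n \<Longrightarrow> factor z i n = factor z j n \<Longrightarrow> real n \<le> s * real (j + k)"
  shows False
proof -
  define Q where "Q D \<longleftrightarrow> (\<exists>w X Y c B t. level z w X Y c B t \<and> N \<le> length w \<and> length X + length Y = length w + D)" for D
  \<comment> \<open>The excess is nonnegative because a word that is not eventually periodic has
    more than |w| factors of length |w|.\<close>
  have ge: "length w \<le> length X + length Y" if "level z w X Y c B t" for w X Y c B t
    using card_factors_level[OF that] card_factors_ge[OF fin np, of "length w"] by linarith
  have exQ: "Q (length X0 + length Y0 - length w0)" unfolding Q_def using lv0 ge[OF lv0(1)] by fastforce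
  define D where "D = (LEAST D. Q D)"
  have D: "Q D" unfolding D_def using exQ by (rule LeastI)
  have D_min: "length w + D \<le> length X + length Y" if "level z w X Y c B t" "N \<le> length w" for w X Y c B t
  proof -
    have "Q (length X + length Y - length w)" unfolding Q_def using that ge[OF that(1)] by fastforce
    then have "D \<le> length X + length Y - length w" unfolding D_def by (rule Least_le)
    then show ?thesis using ge[OF that(1)] by linarith
  qed
  define R where "R x y c \<longleftrightarrow> (\<exists>w X Y B t. level z w X Y c B t \<and> N \<le> length w \<and> x + y = length w + D \<and>
    length X = x \<and> length Y = y)" for x y c
  \<comment> \<open>The error collects the difference \<open>D\<close> between x + y and |w|, the
    shift by \<open>k\<close>, and the uncontrolled lengths below \<open>M\<close>.\<close>
  define K where "K = real D + s * k + real M"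
  obtain x y c where start: "R x y c" using D unfolding Q_def R_def by fastforce
  show False
  proof (rule no_level_orbit[where R = R and K = K, OF s _ start])
    show "0 \<le> K" using s by (simp add: K_def)
    show "0 < x \<and> 0 < y \<and> c \<le> x" if "R x y c" for x y c
      using that by (auto simp: R_def level_def blocks_def)
    fix x y c assume "R x y c"
    then obtain w X Y B t where lv: "level z w X Y c B t" and N: "N \<le> length w" and xy: "x + y = length w + D"
      and len: "length X = x" "length Y = y" unfolding R_def by blast
    note l = levelD[OF lv]
    note b = blocksD[OF l(1)]
    have pos: "0 < x" "0 < y" using b(1,2) len by auto
    have rep': "real n \<le> s * real j + (s * k + real M)" if "i < j" "factor z i n = factor z j n" for i j n
    proof (cases "M \<le> n")
      case True
      then show ?thesis using rep[OF that(1) True that(2)] by (simp add: algebra_simps)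
    next
      case False
      moreover have "0 \<le> s * real j + s * k" using s by simp
      ultimately show ?thesis by linarith
    qed
    have disj: "\<not> t c \<and> (\<forall>p\<in>B. t p \<longrightarrow> \<not> t (p + length X)) \<or> (\<forall>p\<in>B. \<not> t p \<longrightarrow> t (p + length Y))"
    proof (rule level_not_both_squares[OF lv np])
      show "unique_right_special z (Suc (length w))" using N by (intro urs) simp
      fix w' X' Y' c' B' t' assume lv': "level z w' X' Y' c' B' t'" and "length w \<le> length w'"
      then have "length w' + D \<le> length X' + length Y'" using D_min[OF lv'] N by simp
      then show "length X + length Y + length w' \<le> length X' + length Y' + length w"
        using xy len by simp
    qed
    show "real (x + y + c) \<le> s * x + K \<and> R x (x + y) c \<or>
      real (y + c) \<le> s * x + K \<and> real (x + y) \<le> s * real (y + c) + K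
        \<and> (R (x + y) x (c + y) \<or> R (x + y) y c)"
    proof (cases "t c")
      case True
      then have "\<forall>p\<in>B. \<not> t p \<longrightarrow> t (p + length Y)" using disj by blast
      then have "level z (X @ w) X (X @ Y) c {p \<in> B. t p} (\<lambda>p. t (p + length X))"
        using level_step_short(1)[OF lv] True by blast
      then have "R x (x + y) c" unfolding R_def using N xy len
        by (intro exI[of _ "X @ w"] exI[of _ X] exI[of _ "X @ Y"] exI conjI) auto
      moreover have "real (c + length w) \<le> s * real x + (s * k + real M)"
        using rep'[OF _ level_repetition_same[OF lv True]] pos len by simp
      ultimately show ?thesis using xy by (auto simp: K_def)
    next
      case False
      have r1: "real (length w) \<le> s * real (c + y) + (s * k + real M)"
        using rep'[OF _ level_repetition_other(1)[OF lv False]] pos len by simp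
      have "real (c + length w - x) \<le> s * real x + (s * k + real M)"
        using rep'[OF _ level_repetition_other(2)[OF lv False]] pos len by simp
      then have r2: "real (y + c) \<le> s * x + K"
        using xy by (auto simp: K_def of_nat_diff_real split: nat_diff_split_asm)
      have r3: "real (x + y) \<le> s * real (y + c) + K" using r1 xy by (simp add: K_def add.commute)
      from disj have "R (x + y) x (c + y) \<or> R (x + y) y c"
      proof
        assume "\<not> t c \<and> (\<forall>p\<in>B. t p \<longrightarrow> \<not> t (p + length X))"
        then have "level z (Y @ w) (Y @ X) Y c {p \<in> B. \<not> t p} (\<lambda>p. t (p + length Y))"
          using level_step_long[OF lv] by blast
        then have "R (x + y) y c" unfolding R_def using N xy len
          by (intro exI[of _ "Y @ w"] exI[of _ "Y @ X"] exI[of _ Y] exI conjI) auto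
        then show ?thesis ..
      next
        assume "\<forall>p\<in>B. \<not> t p \<longrightarrow> t (p + length Y)"
        then have "level z (X @ w) (X @ Y) X (c + length Y) {p \<in> B. t p} (\<lambda>p. \<not> t (p + length X))"
          using level_step_short(2)[OF lv] False by blast
        then have "R (x + y) x (c + y)" unfolding R_def using N xy len
          by (intro exI[of _ "X @ w"] exI[of _ "X @ Y"] exI[of _ X] exI conjI) auto
        then show ?thesis ..
      qed
      then show ?thesis using r2 r3 by blast
    qed
  qed
qed

text \<open>The cuts are the occurrences of the right special factor \<open>w\<close>, the blocks
  its return words. Between two occurrences each next letter is determined, so the return word
  depends only on the letter after \<open>w\<close>, which takes two values.\<close>

lemma initial_level:
  fixes d :: "nat \<Rightarrow> 'a"
  assumes fin: "finite (range d)" and np: "\<not> eventually_periodic d"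
    and card: "card (factors d (Suc N)) \<le> Suc (card (factors d N))"
  shows "\<exists>k w X Y c B t. level (\<lambda>i. d (i + k)) w X Y c B t \<and> length w = N"
proof -
  note urs = unique_right_special_if_card[OF fin card, unfolded unique_right_special_def, rule_format]
  obtain k q0 where k: "factor d k N = factor d q0 N" "d (k + N) \<noteq> d (q0 + N)"
    using right_special_beyond[OF fin np, of 0 N] by blast
  define w where "w = factor d k N"
  define z where "z i = d (i + k)" for i
  have fz: "factor z p n = factor d (p + k) n" for p n
    unfolding z_def by (rule factor_shift)
  \<comment> \<open>All right special factors of length \<open>N\<close> coincide, so
    \<open>w\<close> recurs arbitrarily far out with different continuations.\<close>
  have sp: "\<exists>p\<ge>m. \<exists>q\<ge>m. factor z p N = w \<and> factor z q N = w \<and> z (p + N) \<noteq> z (q + N)" for m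
  proof -
    obtain p q where pq: "p \<ge> m + k" "q \<ge> m + k" "factor d p N = factor d q N" "d (p + N) \<noteq> d (q + N)"
      using right_special_beyond[OF fin np] by metis
    have "factor d k N = factor d p N" by (rule urs[OF k pq(3,4)])
    then show ?thesis using pq
      by (intro exI[of _ "p - k"] conjI exI[of _ "q - k"]) (auto simp: fz w_def z_def)
  qed
  have det: "z (p + N) = z (q + N)" if "factor z p N = factor z q N" "factor z p N \<noteq> w" for p q
    using urs[OF k, of "p + k" "q + k"] that by (auto simp: fz w_def z_def add_ac)
  obtain P Q where PQ: "factor z P N = w" "factor z Q N = w" "z (P + N) \<noteq> z (Q + N)" using sp by blast
  have two: "z (p + N) = z (P + N) \<or> z (p + N) = z (Q + N)" if "factor z p N = w" for p
    using two_right_extensions_if_card[OF fin card, of "P + k" "Q + k" "p + k"] PQ that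
    by (auto simp: fz z_def add_ac)
  define B where "B = {p. factor z p N = w}"
  have ret: "\<exists>V. V \<noteq> [] \<and> prefix w (V @ w) \<and>
      (\<forall>q\<in>B. z (q + N) = z (p + N) \<longrightarrow> factor z q (length V) = V \<and> q + length V \<in> B)" if "p \<in> B" for p
  proof -
    have ex: "\<exists>r. 0 < r \<and> p + r \<in> B"
    proof -
      obtain q where "q \<ge> Suc p" "factor z q N = w" using sp[of "Suc p"] by blast
      then show ?thesis by (intro exI[of _ "q - p"]) (auto simp: B_def)
    qed
    define r where "r = (LEAST r. 0 < r \<and> p + r \<in> B)"
    have r: "0 < r" "p + r \<in> B" using LeastI_ex[OF ex] unfolding r_def by auto
    have r_min: "p + m \<notin> B" if "0 < m" "m < r" for m
      using not_less_Least[of m "\<lambda>r. 0 < r \<and> p + r \<in> B"] that unfolding r_def by blast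
    have same: "factor z p (N + m) = factor z q (N + m)" if q: "q \<in> B" "z (q + N) = z (p + N)" and "m \<le> r" for q m
      using \<open>m \<le> r\<close>
    proof (induction m)
      case 0
      then show ?case using q(1) \<open>p \<in> B\<close> by (simp add: B_def)
    next
      case (Suc m)
      then have IH: "factor z p (N + m) = factor z q (N + m)" by simp
      have "z (p + (N + m)) = z (q + (N + m))"
      proof (cases "m = 0")
        case True
        then show ?thesis using q by simp
      next
        case False
        have "factor z (p + m) N = factor z (q + m) N"
          using arg_cong[OF IH, of "\<lambda>u. take N (drop m u)"] take_drop_factor[of m N "N + m" z] by simp
        moreover have "factor z (p + m) N \<noteq> w" using r_min[of m] False Suc.prems by (simp add: B_def)
        ultimately show ?thesis using det by (metis add.assoc add.commute)
      qed
      then show ?case using IH by (simp add: factor_Suc)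
    qed
    define V where "V = factor z p r"
    have Vw: "V @ w = factor z p (r + N)" using r(2) by (simp add: V_def factor_add B_def)
    have "factor z q r = V \<and> q + r \<in> B" if "q \<in> B" "z (q + N) = z (p + N)" for q
    proof -
      have "factor z q (r + N) = V @ w" using same[OF that order_refl] Vw by (simp add: add.commute)
      then show ?thesis by (simp add: factor_add B_def V_def)
    qed
    moreover have "prefix w (V @ w)"
    proof -
      have "factor z p (N + r) = w @ factor z (p + N) r" using \<open>p \<in> B\<close> by (simp add: factor_add B_def)
      then show ?thesis unfolding Vw by (simp add: add.commute)
    qed
    moreover have "V \<noteq> []" "length V = r" using r(1) by (auto simp: V_def factor_def)
    ultimately show ?thesis by metis
  qed
  obtain X where X: "X \<noteq> []" "prefix w (X @ w)"
    "\<And>q. q \<in> B \<Longrightarrow> z (q + N) = z (P + N) \<Longrightarrow> factor z q (length X) = X \<and> q + length X \<in> B"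
    using ret[of P] PQ(1) unfolding B_def by auto
  obtain Y where Y: "Y \<noteq> []" "prefix w (Y @ w)"
    "\<And>q. q \<in> B \<Longrightarrow> z (q + N) = z (Q + N) \<Longrightarrow> factor z q (length Y) = Y \<and> q + length Y \<in> B"
    using ret[of Q] PQ(2) unfolding B_def by auto
  have "blocks z w X Y B (\<lambda>p. z (p + N) = z (P + N))"
    unfolding blocks_def using X Y two by (auto simp: B_def)
  moreover have "0 \<in> B" by (simp add: B_def fz w_def)
  ultimately obtain X' Y' c t' where "level z w X' Y' c B t'" using level_from_zero by blast
  then show ?thesis unfolding z_def by (metis w_def length_factor)
qed

section \<open>Digits and rational approximations\<close>

definition digit_word :: "real \<Rightarrow> nat \<Rightarrow> nat \<Rightarrow> nat" where
  "digit_word xi b i = digit xi b (Suc i)"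

lemma complexity_eq_card_factors: "complexity n xi b = card (factors (digit_word xi b) n)"
proof -
  have "map (\<lambda>i. digit xi b (l + 1 + i)) [0..<n] = factor (digit_word xi b) l n" for l
    by (auto simp: list_eq_iff_nth_eq digit_word_def)
  then show ?thesis unfolding complexity_def factors_def by (simp add: full_SetCompr_eq)
qed

lemma frac_digit:
  assumes "b \<ge> 2"
  shows "frac (xi * real b ^ i) * real b = real (digit_word xi b i) + frac (xi * real b ^ Suc i)"
proof -
  define a where "a = xi * real b ^ i"
  have "\<lfloor>a * real b\<rfloor> = \<lfloor>frac a * real b + of_int (\<lfloor>a\<rfloor> * int b)\<rfloor>"
    by (simp add: frac_def algebra_simps)
  then have fl: "\<lfloor>a * real b\<rfloor> = \<lfloor>frac a * real b\<rfloor> + \<lfloor>a\<rfloor> * int b" by (simp only: floor_add_int)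
  have "0 \<le> \<lfloor>frac a * real b\<rfloor>" "\<lfloor>frac a * real b\<rfloor> < int b"
    using frac_lt_1[of a] assms by (auto simp: floor_less_iff)
  then have d: "real (digit_word xi b i) = real_of_int \<lfloor>frac a * real b\<rfloor>"
    using fl unfolding digit_word_def digit_def by (simp add: a_def mult_ac)
  show ?thesis unfolding d using fl by (simp add: frac_def a_def algebra_simps)
qed

lemma finite_range_digit_word: "b \<ge> 2 \<Longrightarrow> finite (range (digit_word xi b))"
proof (rule finite_subset[of _ "{..b}"])
  assume "b \<ge> 2"
  then have "n mod int b \<le> int b" for n by (intro less_imp_le pos_mod_bound) simp
  then show "range (digit_word xi b) \<subseteq> {..b}" by (auto simp: digit_word_def digit_def nat_le_iff)
qed simp

lemma frac_diff_factor:
  assumes b: "b \<ge> 2" and eq: "factor (digit_word xi b) i n = factor (digit_word xi b) j n"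
  shows "(frac (xi * real b ^ i) - frac (xi * real b ^ j)) * real b ^ n =
    frac (xi * real b ^ (i + n)) - frac (xi * real b ^ (j + n))"
  using eq
proof (induction n)
  case (Suc n)
  then have "factor (digit_word xi b) i n = factor (digit_word xi b) j n"
    and d: "digit_word xi b (i + n) = digit_word xi b (j + n)" by (auto simp: factor_Suc)
  then have "(frac (xi * real b ^ i) - frac (xi * real b ^ j)) * real b ^ Suc n =
      frac (xi * real b ^ (i + n)) * real b - frac (xi * real b ^ (j + n)) * real b"
    using arg_cong[OF Suc.IH, of "\<lambda>v. v * real b"] by (simp add: algebra_simps)
  also have "\<dots> = frac (xi * real b ^ (i + Suc n)) - frac (xi * real b ^ (j + Suc n))"
    unfolding frac_digit[OF b] using d by simp
  finally show ?case .
qed simp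

lemma abs_frac_diff_less_1: "\<bar>frac x - frac y\<bar> < (1 :: real)"
  using frac_lt_1[of x] frac_ge_0[of x] frac_lt_1[of y] frac_ge_0[of y] by linarith

text \<open>Together with \<open>rep_den\<close> this is the fraction whose expansion follows
  \<open>digit_word xi b\<close> up to position \<open>j\<close> and then repeats the letters at
  positions \<open>i\<close> to \<open>j - 1\<close> forever.\<close>

definition rep_num :: "real \<Rightarrow> nat \<Rightarrow> nat \<Rightarrow> nat \<Rightarrow> int" where
  "rep_num xi b i j = \<lfloor>xi * real b ^ j\<rfloor> - \<lfloor>xi * real b ^ i\<rfloor>"

definition rep_den :: "nat \<Rightarrow> nat \<Rightarrow> nat \<Rightarrow> int" where
  "rep_den b i j = int b ^ j - int b ^ i"

lemma rep_error:
  "real_of_int (rep_den b i j) * xi - real_of_int (rep_num xi b i j) = frac (xi * real b ^ j) - frac (xi * real b ^ i)"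
  by (simp add: rep_den_def rep_num_def frac_def algebra_simps)

lemma rep_den_bounds:
  assumes "b \<ge> 2" "i < j"
  shows "1 \<le> rep_den b i j" "real_of_int (rep_den b i j) \<le> real b ^ j"
proof -
  have "int b ^ i < int b ^ j" using assms by (intro power_strict_increasing) auto
  then show "1 \<le> rep_den b i j" by (simp add: rep_den_def)
  show "real_of_int (rep_den b i j) \<le> real b ^ j" by (simp add: rep_den_def)
qed

lemma rep_error_less:
  assumes b: "b \<ge> 2" and eq: "factor (digit_word xi b) i n = factor (digit_word xi b) j n"
  shows "\<bar>real_of_int (rep_den b i j) * xi - real_of_int (rep_num xi b i j)\<bar> * real b ^ n < 1"
proof -
  have "\<bar>real_of_int (rep_den b i j) * xi - real_of_int (rep_num xi b i j)\<bar> * real b ^ n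
      = \<bar>(frac (xi * real b ^ i) - frac (xi * real b ^ j)) * real b ^ n\<bar>"
    by (simp add: rep_error abs_mult abs_minus_commute)
  then show ?thesis unfolding frac_diff_factor[OF b eq] using abs_frac_diff_less_1 by simp
qed

text \<open>A period makes the error of one fixed fraction smaller than every negative power of
  \<open>b\<close>, hence zero.\<close>

lemma digit_word_not_periodic:
  assumes xi: "xi \<notin> \<rat>" and b: "b \<ge> 2"
  shows "\<not> eventually_periodic (digit_word xi b)"
proof
  assume "eventually_periodic (digit_word xi b)"
  then obtain s t where t: "0 < t" and per: "\<And>i. s \<le> i \<Longrightarrow> digit_word xi b (i + t) = digit_word xi b i"
    unfolding eventually_periodic_def by blast
  let ?e = "real_of_int (rep_den b s (s + t)) * xi - real_of_int (rep_num xi b s (s + t))"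
  have "factor (digit_word xi b) s n = factor (digit_word xi b) (s + t) n" for n
    unfolding factor_eq_factor_iff using per by (metis add.assoc add.commute le_add1)
  then have small: "\<bar>?e\<bar> * real b ^ n < 1" for n using rep_error_less[OF b] by blast
  have "?e = 0"
  proof (rule ccontr)
    assume "?e \<noteq> 0"
    then have pos: "\<bar>?e\<bar> > 0" by simp
    obtain n where "1 / \<bar>?e\<bar> < real b ^ n" using real_arch_pow[of "real b" "1 / \<bar>?e\<bar>"] b by auto
    then show False using small[of n] pos by (simp add: field_simps)
  qed
  moreover have "rep_den b s (s + t) \<ge> 1" using rep_den_bounds(1)[OF b, of s "s + t"] t by simp
  ultimately have "xi = of_int (rep_num xi b s (s + t)) / of_int (rep_den b s (s + t))" by (simp add: field_simps)
  then show False using xi by (metis Rats_divide Rats_of_int)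
qed

section \<open>Approximations forced by low complexity\<close>

definition approximants :: "real \<Rightarrow> real \<Rightarrow> (int \<times> int) set" where
  "approximants xi mu = {pq. snd pq \<ge> 1 \<and>
     \<bar>xi - real_of_int (fst pq) / real_of_int (snd pq)\<bar> < real_of_int (snd pq) powr (- mu)}"

lemma irrationality_exponent_eq:
  "irrationality_exponent xi = Sup {ereal mu | mu. infinite (approximants xi mu)}"
  by (simp add: irrationality_exponent_def approximants_def)

text \<open>The denominator q is at most b^j, so the error |q xi - p| < b^-n is below q^-s; division
  by q adds 1 to the exponent.\<close>

lemma repetition_approximant:
  assumes b: "b \<ge> 2" and ij: "i < j" and eq: "factor (digit_word xi b) i n = factor (digit_word xi b) j n"
    and s: "0 \<le> s" "s * real j \<le> real n"
  shows "(rep_num xi b i j, rep_den b i j) \<in> approximants xi (1 + s)"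
proof -
  let ?Q = "real_of_int (rep_den b i j)" and ?P = "real_of_int (rep_num xi b i j)"
  note Q = rep_den_bounds[OF b ij]
  have Q1: "?Q \<ge> 1" using Q(1) by simp
  have "?Q powr s \<le> (real b ^ j) powr s" using Q1 Q(2) s(1) by (intro powr_mono2) auto
  also have "\<dots> = real b powr (real j * s)" using b by (simp add: powr_realpow[symmetric] powr_powr)
  also have "\<dots> \<le> real b powr real n" using s(2) b by (intro powr_mono) (auto simp: mult.commute)
  also have "\<dots> = real b ^ n" using b by (simp add: powr_realpow)
  finally have Qs: "?Q powr s \<le> real b ^ n" .
  have "\<bar>?Q * xi - ?P\<bar> < 1 / real b ^ n"
    using rep_error_less[OF b eq] b by (simp add: field_simps)
  also have "\<dots> \<le> 1 / ?Q powr s" using Qs Q1 b by (intro divide_left_mono) auto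
  also have "\<dots> = ?Q powr (- s)" by (simp add: powr_minus_divide)
  finally have "\<bar>?Q * xi - ?P\<bar> / ?Q < ?Q powr (- s) / ?Q" using Q1 by (intro divide_strict_right_mono) auto
  also have "\<dots> = ?Q powr (- (1 + s))" using Q1 by (simp add: powr_diff powr_minus powr_add field_simps)
  also have "\<bar>?Q * xi - ?P\<bar> / ?Q = \<bar>xi - ?P / ?Q\<bar>"
    using Q1 by (simp add: abs_divide[symmetric] field_simps del: abs_divide) (simp add: abs_if field_simps)
  finally show ?thesis using Q(1) by (simp add: approximants_def)
qed

text \<open>Finitely many approximants would have errors |q xi - p| bounded below, whereas a long
  repetition with n > s j gives one with smaller error. So all long repetitions would obey the bound
  refuted by \<open>levels_force_repetitions\<close>.\<close>

lemma infinite_approximants_if_low_complexity: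
  assumes xi: "xi \<notin> \<rat>" and b: "b \<ge> 2"
    and card: "\<And>n. n \<ge> N \<Longrightarrow> complexity (Suc n) xi b \<le> Suc (complexity n xi b)"
    and s: "1 \<le> s" "s < 2/3 + 4/15 * sqrt 10"
  shows "infinite (approximants xi (1 + s))"
proof
  assume fin: "finite (approximants xi (1 + s))"
  let ?d = "digit_word xi b"
  note fr = finite_range_digit_word[OF b, of xi] and np = digit_word_not_periodic[OF xi b]
  have card': "card (factors ?d (Suc n)) \<le> Suc (card (factors ?d n))" if "n \<ge> N" for n
    using card[OF that] by (simp add: complexity_eq_card_factors)
  obtain k w X Y c B t where lv: "level (\<lambda>i. ?d (i + k)) w X Y c B t" "length w = N"
    using initial_level[OF fr np card'[OF order_refl]] by blast
  define g where "g = (\<lambda>pq :: int \<times> int. \<bar>real_of_int (snd pq) * xi - real_of_int (fst pq)\<bar>)"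
  have gpos: "0 < g pq" if "pq \<in> approximants xi (1 + s)" for pq
  proof -
    have "real_of_int (snd pq) * xi \<noteq> real_of_int (fst pq)"
    proof
      assume "real_of_int (snd pq) * xi = real_of_int (fst pq)"
      moreover have "snd pq \<ge> 1" using that by (simp add: approximants_def)
      ultimately have "xi = of_int (fst pq) / of_int (snd pq)" by (simp add: field_simps)
      then show False using xi by (metis Rats_divide Rats_of_int)
    qed
    then show ?thesis by (simp add: g_def)
  qed
  \<comment> \<open>The inserted 1 keeps the minimum meaningful if there are no approximants at
    all.\<close>
  define e where "e = Min (insert 1 (g ` approximants xi (1 + s)))"
  have e: "0 < e" "\<And>pq. pq \<in> approximants xi (1 + s) \<Longrightarrow> e \<le> g pq"
    using fin gpos by (auto simp: e_def)
  obtain M where M: "1 / e < real b ^ M" using real_arch_pow[of "real b" "1 / e"] b by auto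
  show False
  proof (rule levels_force_repetitions[OF _ _ _ lv(1) _ s])
    show "finite (range (\<lambda>i. ?d (i + k)))" using fr by (rule finite_subset[rotated]) auto
    show "\<not> eventually_periodic (\<lambda>i. ?d (i + k))" using np eventually_periodic_shift[of ?d k] by blast
    show "unique_right_special (\<lambda>i. ?d (i + k)) n" if "n \<ge> N" for n
      by (rule unique_right_special_shift[OF unique_right_special_if_card[OF fr card'[OF that]]])
    show "N \<le> length w" using lv(2) by simp
    fix i j n :: nat assume ij: "i < j" and n: "M \<le> n"
      and "factor (\<lambda>i. ?d (i + k)) i n = factor (\<lambda>i. ?d (i + k)) j n"
    then have eq: "factor ?d (i + k) n = factor ?d (j + k) n" by (simp add: factor_shift)
    show "real n \<le> s * real (j + k)"
    proof (rule ccontr)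
      assume "\<not> ?thesis"
      then have mem: "(rep_num xi b (i + k) (j + k), rep_den b (i + k) (j + k)) \<in> approximants xi (1 + s)"
        using repetition_approximant[OF b _ eq] ij s(1) by simp
      have "e * real b ^ n < 1"
        using rep_error_less[OF b eq] e(2)[OF mem] mult_right_mono[of e _ "real b ^ n"] by (fastforce simp: g_def)
      moreover have "real b ^ M \<le> real b ^ n" using n b by (intro power_increasing) auto
      then have "1 < e * real b ^ n" using M e(1) by (simp add: field_simps) (smt (verit) mult_left_mono)
      ultimately show False by linarith
    qed
  qed
qed

section \<open>Growth of the complexity and lower bounds for the irrationality exponent\<close>

lemma complexity_Suc:
  assumes "xi \<notin> \<rat>" "b \<ge> 2"
  shows "complexity n xi b < complexity (Suc n) xi b"
  unfolding complexity_eq_card_factors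
  using card_factors_Suc[OF finite_range_digit_word digit_word_not_periodic] assms by blast

lemma complexity_ge:
  assumes "xi \<notin> \<rat>" "b \<ge> 2"
  shows "n < complexity n xi b"
  unfolding complexity_eq_card_factors
  using card_factors_ge[OF finite_range_digit_word digit_word_not_periodic] assms by blast

lemma complexity_minus_mono:
  assumes "xi \<notin> \<rat>" "b \<ge> 2" "m \<le> n"
  shows "complexity m xi b + (n - m) \<le> complexity n xi b"
  using assms(3)
proof (induction n rule: dec_induct)
  case (step n)
  then show ?case using complexity_Suc[OF assms(1,2), of n] by simp
qed simp

text \<open>The difference p(n) - n never decreases, so infinitely many increments of p by at least
  2 would drive it to infinity.\<close>

lemma low_complexity_if_not_tendsto:
  assumes xi: "xi \<notin> \<rat>" and b: "b \<ge> 2"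
    and nt: "\<not> filterlim (\<lambda>n. real (complexity n xi b) - real n) at_top sequentially"
  shows "\<exists>N. \<forall>n\<ge>N. complexity (Suc n) xi b \<le> Suc (complexity n xi b)"
proof (rule ccontr)
  assume "\<not> ?thesis"
  then have jump: "\<exists>n\<ge>N. complexity n xi b + 2 \<le> complexity (Suc n) xi b" for N
    by (metis Suc_leI add_2_eq_Suc' not_less)
  note mono = complexity_minus_mono[OF xi b]
  have unb: "\<exists>n. complexity n xi b \<ge> n + C" for C
  proof (induction C)
    case 0
    then show ?case using complexity_ge[OF xi b, of 0] by (intro exI[of _ 0]) simp
  next
    case (Suc C)
    then obtain n where n: "complexity n xi b \<ge> n + C" by blast
    obtain m where m: "m \<ge> n" "complexity m xi b + 2 \<le> complexity (Suc m) xi b" using jump by blast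
    show ?case using n m mono[OF m(1)] by (intro exI[of _ "Suc m"]) simp
  qed
  have "filterlim (\<lambda>n. real (complexity n xi b) - real n) at_top sequentially"
    unfolding filterlim_at_top
  proof
    fix Z :: real
    obtain n where n: "complexity n xi b \<ge> n + nat \<lceil>Z\<rceil>" using unb by blast
    have "Z \<le> real (complexity m xi b) - real m" if "m \<ge> n" for m
    proof -
      have "m + nat \<lceil>Z\<rceil> \<le> complexity m xi b" using mono[OF that] n that by linarith
      then have "real m + real (nat \<lceil>Z\<rceil>) \<le> real (complexity m xi b)" by (metis of_nat_add of_nat_le_iff)
      then show ?thesis using real_nat_ceiling_ge[of Z] by linarith
    qed
    then show "\<forall>\<^sub>F n in sequentially. Z \<le> real (complexity n xi b) - real n"
      unfolding eventually_sequentially by blast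
  qed
  then show False using nt by blast
qed

lemma irrationality_exponent_ge_if_low_complexity:
  assumes "xi \<notin> \<rat>" "b \<ge> 2" "\<And>n. n \<ge> N \<Longrightarrow> complexity (Suc n) xi b \<le> Suc (complexity n xi b)"
  shows "ereal (5/3 + 4/15 * sqrt 10) \<le> irrationality_exponent xi"
proof (rule ccontr)
  assume "\<not> ?thesis"
  then have "irrationality_exponent xi < ereal (5/3 + 4/15 * sqrt 10)" by simp
  moreover have "ereal 2 < ereal (5/3 + 4/15 * sqrt 10)"
  proof -
    have "3 \<le> sqrt 10" by (rule real_le_rsqrt) simp
    then show ?thesis by simp
  qed
  \<comment> \<open>The maximum with 2 ensures \<open>mu - 1 \<ge> 1\<close>, as needed for the
    slope.\<close>
  ultimately have "max (ereal 2) (irrationality_exponent xi) < ereal (5/3 + 4/15 * sqrt 10)" by simp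
  then obtain mu where mu: "max (ereal 2) (irrationality_exponent xi) < ereal mu" "ereal mu < ereal (5/3 + 4/15 * sqrt 10)"
    using ereal_dense2 by blast
  have "infinite (approximants xi (1 + (mu - 1)))"
    by (rule infinite_approximants_if_low_complexity[OF assms]) (use mu in auto)
  then have "ereal mu \<le> irrationality_exponent xi"
    unfolding irrationality_exponent_eq by (intro Sup_upper) auto
  then show False using mu by (simp add: leD)
qed

text \<open>A fraction \<open>p / q\<close> is compared with the approximation \<open>P / Q\<close> belonging to the \<open>v\<close> for which \<open>q\<close> has
  order of magnitude \<open>b ^ v\<close>: either the determinant \<open>p * Q - P * q\<close> vanishes or \<open>p / q\<close> is a poor
  approximation.\<close>

lemma finite_approximants:
  fixes xi s mu a A :: real and b :: nat
  assumes b: "b \<ge> 2" and s: "1 \<le> s" "1 + s < mu" and a: "0 < a" "1 \<le> A"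
    and cover: "\<And>v. v \<ge> v0 \<Longrightarrow> \<exists>t t' P Q. t \<le> v \<and> v < t' \<and> real t' \<le> s * real t \<and> 1 \<le> Q \<and>
      real_of_int Q \<le> real b ^ t \<and> a \<le> \<bar>real_of_int Q * xi - real_of_int P\<bar> * real b ^ t' \<and>
      \<bar>real_of_int Q * xi - real_of_int P\<bar> * real b ^ t' \<le> A"
  shows "finite (approximants xi mu)"
proof -
  let ?b = "real b"
  have b1: "1 < ?b" using b by simp
  have mu: "2 < mu" using s by simp
  \<comment> \<open>For large q the first quantity keeps the determinant below 1, and the second
    contradicts the lower bound for the error in the case of a vanishing determinant.\<close>
  have lim1: "((\<lambda>q. 4 * A * q powr (2 - mu)) \<longlongrightarrow> 4 * A * 0) at_top"
    by (intro tendsto_intros tendsto_neg_powr filterlim_ident) (use mu in simp)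
  then have "\<forall>\<^sub>F q in at_top. 4 * A * q powr (2 - mu) < 1/2"
    by (intro order_tendstoD) auto
  moreover have lim2: "((\<lambda>q. q powr (1 + s - mu)) \<longlongrightarrow> 0) at_top"
    by (intro tendsto_neg_powr filterlim_ident) (use s in simp)
  then have "\<forall>\<^sub>F q in at_top. q powr (1 + s - mu) < a / (4 * A) powr (1 + s)"
    by (intro order_tendstoD) (use a in auto)
  ultimately have "\<forall>\<^sub>F q in at_top. 4 * A * q powr (2 - mu) < 1/2 \<and> q powr (1 + s - mu) < a / (4 * A) powr (1 + s)"
    by (rule eventually_conj)
  then obtain q0 where q0: "\<And>q. q \<ge> q0 \<Longrightarrow> 4 * A * q powr (2 - mu) < 1/2 \<and> q powr (1 + s - mu) < a / (4 * A) powr (1 + s)"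
    unfolding eventually_at_top_linorder by blast
  define q1 where "q1 = max q0 (?b ^ Suc v0)"
  have bounded: "real_of_int q < q1" if "(p, q) \<in> approximants xi mu" for p q
  proof (rule ccontr)
    assume "\<not> real_of_int q < q1"
    then have q: "q0 \<le> q" "?b ^ Suc v0 \<le> q" by (auto simp: q1_def)
    have q1: "1 \<le> q" and err: "\<bar>xi - real_of_int p / q\<bar> < q powr (- mu)" using that by (auto simp: approximants_def)
    then have qpos: "0 < real_of_int q" by simp
    \<comment> \<open>With V = v + 1 this places 4 A q between b^v and b^(v + 1); the factor 4 A
      makes one of the two terms of the determinant at most 1/4.\<close>
    define V where "V = (LEAST v. 4 * A * q \<le> ?b ^ v)"
    have "\<exists>v. 4 * A * q \<le> ?b ^ v" using real_arch_pow[OF b1, of "4 * A * q"] less_imp_le by blast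
    then have V: "4 * A * q \<le> ?b ^ V" unfolding V_def by (rule LeastI_ex)
    have "?b ^ Suc v0 < 4 * A * q"
    proof -
      have "1 * real_of_int q < 4 * A * q" using qpos a by (intro mult_strict_right_mono) auto
      then show ?thesis using q(2) by linarith
    qed
    then have "?b ^ Suc v0 < ?b ^ V" using V by linarith
    then have "Suc v0 < V" using b1 power_less_imp_less_exp by blast
    then obtain v where v: "V = Suc v" "v0 \<le> v" by (cases V) auto
    have v2: "?b ^ v < 4 * A * q" using not_less_Least[of v "\<lambda>v. 4 * A * q \<le> ?b ^ v"] v(1) unfolding V_def by auto
    obtain t t' P Q where t: "t \<le> v" "v < t'" "real t' \<le> s * real t" "1 \<le> Q" "real_of_int Q \<le> ?b ^ t"
      "a \<le> \<bar>real_of_int Q * xi - real_of_int P\<bar> * ?b ^ t'" "\<bar>real_of_int Q * xi - real_of_int P\<bar> * ?b ^ t' \<le> A"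
      using cover[OF v(2)] by blast
    have "?b ^ t \<le> ?b ^ v" "?b ^ Suc v \<le> ?b ^ t'" using t(1,2) b1 by (intro power_increasing; simp)+
    then have bt: "?b ^ t < 4 * A * q" and bt': "4 * A * q \<le> ?b ^ t'" using v2 V v(1) by auto
    define E where "E = \<bar>real_of_int Q * xi - real_of_int P\<bar>"
    define e where "e = \<bar>real_of_int q * xi - real_of_int p\<bar>"
    have e: "e < q powr (1 - mu)"
    proof -
      have "e = q * \<bar>xi - real_of_int p / q\<bar>"
      proof -
        have "real_of_int q * xi - p = q * (xi - real_of_int p / q)" using qpos by (simp add: field_simps)
        then show ?thesis unfolding e_def using qpos by (simp add: abs_mult)
      qed
      also have "\<dots> < q * q powr (- mu)" using err qpos by simp
      also have "\<dots> = q powr (1 - mu)" using qpos by (simp add: powr_diff powr_minus field_simps)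
      finally show ?thesis .
    qed
    have "real_of_int \<bar>p * Q - P * q\<bar> = \<bar>q * (real_of_int Q * xi - P) - Q * (real_of_int q * xi - p)\<bar>"
      by (simp add: algebra_simps)
    also have "\<dots> \<le> q * E + Q * e"
      unfolding E_def e_def using qpos t(4) by (intro order_trans[OF abs_triangle_ineq4]) (simp add: abs_mult)
    also have "q * E \<le> 1/4"
    proof -
      have "4 * (q * E) * A = (4 * A * q) * E" by simp
      also have "\<dots> \<le> ?b ^ t' * E" using bt' by (intro mult_right_mono) (auto simp: E_def)
      also have "\<dots> \<le> 1 * A" using t(7) by (simp add: E_def mult.commute)
      finally have "4 * (q * E) \<le> 1" using a by (simp add: mult_le_cancel_right)
      then show ?thesis by simp
    qed
    also have "Q * e \<le> 4 * A * q powr (2 - mu)"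
    proof -
      have "Q * e \<le> (4 * A * q) * q powr (1 - mu)"
        using t(4,5) bt e qpos a by (intro mult_mono) (auto simp: e_def)
      also have "\<dots> = 4 * A * q powr (2 - mu)"
        using qpos powr_mult_base[of "real_of_int q" "1 - mu"] by simp
      finally show ?thesis .
    qed
    finally have "real_of_int \<bar>p * Q - P * q\<bar> < 1" using q0[OF q(1)] by simp
    then have "\<bar>p * Q - P * q\<bar> < 1" by (simp only: of_int_less_1_iff)
    then have "p * Q = P * q" by simp
    then have "real_of_int p * Q = P * real_of_int q" by (metis of_int_mult)
    then have pq: "real_of_int p / q = P / real_of_int Q" using qpos t(4) by (simp add: field_simps)
    \<comment> \<open>Both fractions are equal, so the error of p/q is at least of order b^-(t +
      t'). With t' <= s t and b^t < 4 A q this is at least of order q^-(1 + s), too large for the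
      exponent \<open>mu\<close>.\<close>
    have "E = \<bar>xi - real_of_int p / q\<bar> * Q"
    proof -
      have "real_of_int Q * xi - P = (xi - P / real_of_int Q) * Q" using t(4) by (simp add: field_simps)
      then show ?thesis unfolding E_def pq
        using t(4) by (simp add: abs_mult)
    qed
    also have "\<dots> \<le> q powr (- mu) * ?b ^ t" using err t(4,5) by (intro mult_mono) auto
    finally have "E * ?b ^ t' \<le> q powr (- mu) * ?b ^ t * ?b ^ t'" by (rule mult_right_mono) simp
    then have "a \<le> q powr (- mu) * ?b ^ t * ?b ^ t'" using t(6) unfolding E_def by linarith
    also have "\<dots> = q powr (- mu) * ?b powr (real t + real t')"
      using b1 by (simp add: powr_add powr_realpow)
    also have "\<dots> \<le> q powr (- mu) * ?b powr (real t * (1 + s))"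
      using b1 t(3) by (intro mult_left_mono powr_mono) (auto simp: algebra_simps)
    also have "\<dots> = q powr (- mu) * (?b ^ t) powr (1 + s)"
      using b1 by (simp add: powr_realpow[symmetric] powr_powr)
    also have "\<dots> \<le> q powr (- mu) * (4 * A * q) powr (1 + s)"
      using bt s b1 by (intro mult_left_mono powr_mono2) auto
    also have "\<dots> = (4 * A) powr (1 + s) * q powr (1 + s - mu)"
      using a qpos by (simp add: powr_mult powr_diff powr_minus field_simps powr_add)
    finally have "a / (4 * A) powr (1 + s) \<le> q powr (1 + s - mu)"
      using a by (simp add: field_simps)
    then show False using q0[OF q(1)] by simp
  qed
  define H where "H = \<lceil>q1 * (\<bar>xi\<bar> + 1)\<rceil>"
  have "approximants xi mu \<subseteq> {-H..H} \<times> {1..\<lceil>q1\<rceil>}"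
  proof
    fix pq assume pq: "pq \<in> approximants xi mu"
    obtain p q where [simp]: "pq = (p, q)" by force
    have q: "1 \<le> q" and err: "\<bar>xi - real_of_int p / q\<bar> < q powr (- mu)" using pq by (auto simp: approximants_def)
    have lt: "real_of_int q < q1" using bounded pq by simp
    have "real_of_int q powr (- mu) \<le> real_of_int q powr 0" using q mu by (intro powr_mono) auto
    then have "\<bar>xi - real_of_int p / q\<bar> < 1" using err q by simp
    then have "\<bar>real_of_int p / q\<bar> \<le> \<bar>xi\<bar> + 1" by linarith
    then have "\<bar>real_of_int p\<bar> \<le> q * (\<bar>xi\<bar> + 1)" using q by (simp add: field_simps)
    also have "\<dots> \<le> q1 * (\<bar>xi\<bar> + 1)" using lt by (intro mult_right_mono) auto
    finally have "\<bar>p\<bar> \<le> H" unfolding H_def by linarith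
    moreover have "q \<le> \<lceil>q1\<rceil>" using lt by linarith
    ultimately show "pq \<in> {-H..H} \<times> {1..\<lceil>q1\<rceil>}" using q by auto
  qed
  then show ?thesis by (rule finite_subset) auto
qed

text \<open>Pairs are not reduced, so the multiples of one fraction are infinitely many approximants
  with error 0.\<close>

lemma irrational_if_finite_approximants:
  assumes "finite (approximants xi mu)"
  shows "xi \<notin> \<rat>"
proof
  assume "xi \<in> \<rat>"
  then obtain p q where xi: "xi = real_of_int p / real_of_int q" "q > 0" by (rule Rats_cases')
  have "range (\<lambda>k. (int (Suc k) * p, int (Suc k) * q)) \<subseteq> approximants xi mu"
    using xi by (auto simp: approximants_def mult_pos_pos int_one_le_iff_zero_less simp del: of_nat_Suc)
  moreover have "inj (\<lambda>k. (int (Suc k) * p, int (Suc k) * q))"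
    using xi(2) by (auto simp: inj_on_def)
  ultimately show False using assms by (meson finite_subset range_inj_infinite)
qed

definition expansion :: "(nat \<Rightarrow> nat) \<Rightarrow> nat \<Rightarrow> nat \<Rightarrow> real" where
  "expansion z b i = (\<Sum>l. real (z (i + l)) / real b ^ Suc l)"

text \<open>Isolated ones keep all tails away from 1 even in base 2. Hence the digits are recovered
  from the number, and tails with different first digits are well separated.\<close>

locale sparse_binary_word =
  fixes z :: "nat \<Rightarrow> nat" and b :: nat
  assumes b: "b \<ge> 2" and le1: "z i \<le> 1" and sparse: "z i = 1 \<Longrightarrow> z (Suc i) = 0"
begin

lemma summable_expansion: "summable (\<lambda>l. real (z (i + l)) / real b ^ Suc l)"
proof (rule summable_comparison_test)
  have "summable (\<lambda>l. (1 / real b) ^ l)" using b by (intro summable_geometric) auto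
  then show "summable (\<lambda>l. (1 / real b) ^ Suc l)" by (subst summable_Suc_iff)
  have "real (z (i + l)) / real b ^ Suc l \<le> (1 / real b) ^ Suc l" for l
    using le1[of "i + l"] b by (simp add: field_simps power_one_over)
  then show "\<exists>N. \<forall>n\<ge>N. norm (real (z (i + n)) / real b ^ Suc n) \<le> (1 / real b) ^ Suc n" by auto
qed

lemma expansion_Suc: "expansion z b i * real b = real (z i) + expansion z b (Suc i)"
proof -
  have "expansion z b i = real (z i) / real b + (\<Sum>l. real (z (i + Suc l)) / real b ^ Suc (Suc l))"
    unfolding expansion_def using suminf_split_head[OF summable_expansion[of i]] by simp
  also have "(\<Sum>l. real (z (i + Suc l)) / real b ^ Suc (Suc l)) = (\<Sum>l. real (z (Suc i + l)) / real b ^ Suc l) / real b"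
    by (subst suminf_divide[OF summable_expansion[of "Suc i"], symmetric]) (simp add: mult.commute)
  finally show ?thesis using b by (simp add: expansion_def field_simps)
qed

lemma expansion_nonneg: "0 \<le> expansion z b i"
  unfolding expansion_def by (intro suminf_nonneg summable_expansion) auto

lemma expansion_le_1: "expansion z b i \<le> 1"
proof -
  have sm: "summable (\<lambda>l. (1 / real b) ^ l)" using b by (intro summable_geometric) auto
  then have sm': "summable (\<lambda>l. (1 / real b) ^ Suc l)" by (subst summable_Suc_iff)
  have "expansion z b i \<le> (\<Sum>l. (1 / real b) ^ Suc l)"
    unfolding expansion_def using le1 b
    by (intro suminf_le summable_expansion sm') (simp add: field_simps power_one_over)
  also have "\<dots> = (1 / real b) * (1 / (1 - 1 / real b))"
    unfolding power_Suc using suminf_mult[OF sm, of "1 / real b"] suminf_geometric[of "1 / real b"] b by simp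
  also have "\<dots> \<le> 1" using b by (simp add: field_simps)
  finally show ?thesis .
qed

text \<open>A tail starting with 0 is at most 1/2, so one starting with 1 is at most (1 + 1/2) /
  2.\<close>

lemma expansion_le: "expansion z b i \<le> 3/4"
proof -
  have half: "expansion z b j \<le> 1/2" if "z j = 0" for j
  proof -
    have "expansion z b j * 2 \<le> expansion z b j * real b" using b expansion_nonneg[of j] by (intro mult_left_mono) auto
    then show ?thesis using expansion_Suc[of j] expansion_le_1[of "Suc j"] that by simp
  qed
  show ?thesis
  proof (cases "z i = 0")
    case True
    then show ?thesis using half[of i] by simp
  next
    case False
    then have z: "z i = 1" using le1[of i] by simp
    have "expansion z b i * 2 \<le> expansion z b i * real b" using b expansion_nonneg[of i] by (intro mult_left_mono) auto
    then show ?thesis using expansion_Suc[of i] half[OF sparse[OF z]] z by simp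
  qed
qed

text \<open>A tail with first digit 1 is at least 1/b, one with first digit 0 at most 3/(4
  b).\<close>

lemma expansion_diff:
  assumes "z i \<noteq> z j"
  shows "1 / (4 * real b) \<le> \<bar>expansion z b i - expansion z b j\<bar>"
proof -
  have main: "1 / (4 * real b) \<le> expansion z b i - expansion z b j" if "z i = 1" "z j = 0" for i j
  proof -
    have "1 \<le> expansion z b i * real b" "expansion z b j * real b \<le> 3/4"
      using expansion_Suc[of i] expansion_nonneg[of "Suc i"] expansion_Suc[of j] expansion_le[of "Suc j"] that by simp_all
    then show ?thesis using b by (simp add: field_simps)
  qed
  have "z i = 1 \<and> z j = 0 \<or> z j = 1 \<and> z i = 0" using assms le1[of i] le1[of j] by linarith
  then show ?thesis using main[of i j] main[of j i] by auto
qed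

lemma frac_expansion: "frac (expansion z b 0 * real b ^ i) = expansion z b i"
proof -
  have "\<exists>k::int. expansion z b 0 * real b ^ i = of_int k + expansion z b i"
  proof (induction i)
    case 0
    then show ?case by (intro exI[of _ 0]) simp
  next
    case (Suc i)
    then obtain k :: int where k: "expansion z b 0 * real b ^ i = of_int k + expansion z b i" by blast
    have "expansion z b 0 * real b ^ Suc i = (of_int k + expansion z b i) * real b"
      unfolding k[symmetric] by (simp add: mult_ac)
    also have "\<dots> = of_int (k * int b + int (z i)) + expansion z b (Suc i)"
      using expansion_Suc[of i] by (simp add: algebra_simps)
    finally show ?case by blast
  qed
  then obtain k :: int where "expansion z b 0 * real b ^ i = of_int k + expansion z b i" by blast
  then show ?thesis using expansion_nonneg[of i] expansion_le[of i]
    by (simp add: frac_unique_iff)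
qed

lemma digit_word_expansion: "digit_word (expansion z b 0) b = z"
proof
  fix i
  have "expansion z b i * real b = real (digit_word (expansion z b 0) b i) + expansion z b (Suc i)"
    using frac_digit[OF b, of "expansion z b 0" i] by (simp only: frac_expansion)
  then show "digit_word (expansion z b 0) b i = z i" using expansion_Suc[of i] by simp
qed

text \<open>A repetition that cannot be prolonged has error of exact order b^-n. The shift by 2
  matches |X| + |Y| = |w| + 2, so that the exponents become sums of stage lengths.\<close>

lemma repetition_approximation:
  assumes ij: "i < j" and eq: "factor z i n = factor z j n" and ne: "z (i + n) \<noteq> z (j + n)"
  shows "\<exists>P Q. 1 \<le> Q \<and> real_of_int Q \<le> real b ^ j \<and>
    1/4 \<le> \<bar>real_of_int Q * expansion z b 0 - real_of_int P\<bar> * real b ^ (n + 2) \<and>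
    \<bar>real_of_int Q * expansion z b 0 - real_of_int P\<bar> * real b ^ (n + 2) \<le> real b ^ 2"
proof -
  let ?x = "expansion z b 0"
  let ?E = "\<bar>real_of_int (rep_den b i j) * ?x - real_of_int (rep_num ?x b i j)\<bar>"
  have "(expansion z b i - expansion z b j) * real b ^ n = expansion z b (i + n) - expansion z b (j + n)"
    using frac_diff_factor[OF b, of ?x i n j] eq unfolding digit_word_expansion frac_expansion by blast
  then have E: "?E * real b ^ n = \<bar>expansion z b (i + n) - expansion z b (j + n)\<bar>"
    unfolding rep_error frac_expansion by (metis abs_minus_commute abs_mult abs_of_nonneg of_nat_0_le_iff zero_le_power)
  have "1 / (4 * real b) * real b ^ 2 \<le> ?E * real b ^ n * real b ^ 2"
    unfolding E using expansion_diff[OF ne] by (intro mult_right_mono) auto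
  moreover have "1/4 \<le> 1 / (4 * real b) * real b ^ 2" using b by (simp add: power2_eq_square)
  moreover have "?E * real b ^ n * real b ^ 2 \<le> 1 * real b ^ 2"
    unfolding E using expansion_nonneg[of "i + n"] expansion_nonneg[of "j + n"] expansion_le_1[of "i + n"] expansion_le_1[of "j + n"]
    by (intro mult_right_mono) auto
  ultimately have "1/4 \<le> ?E * real b ^ (n + 2)" "?E * real b ^ (n + 2) \<le> real b ^ 2"
    unfolding power_add mult.assoc by linarith+
  then show ?thesis using rep_den_bounds[OF b ij] by blast
qed

end

section \<open>The extremal word\<close>

lemma nth_if_factor_eq: "factor z p n = u \<Longrightarrow> i < n \<Longrightarrow> z (p + i) = u ! i"
  by auto

inductive_set generated :: "'a list \<Rightarrow> 'a list \<Rightarrow> 'a list set" for X Y where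
  Nil: "[] \<in> generated X Y"
| left: "u \<in> generated X Y \<Longrightarrow> X @ u \<in> generated X Y"
| right: "u \<in> generated X Y \<Longrightarrow> Y @ u \<in> generated X Y"

lemma generated_append: "u \<in> generated X Y \<Longrightarrow> v \<in> generated X Y \<Longrightarrow> u @ v \<in> generated X Y"
  by (induction rule: generated.induct) (auto intro: generated.intros)

lemma prefix_generated:
  assumes "u \<in> generated X Y" "prefix w (X @ w)" "prefix w (Y @ w)"
  shows "prefix w (u @ w)"
  using assms(1)
proof (induction rule: generated.induct)
  case (left u)
  then have "prefix (X @ w) ((X @ u) @ w)" by simp
  then show ?case using assms(2) prefix_order.trans by blast
next
  case (right u)
  then have "prefix (Y @ w) ((Y @ u) @ w)" by simp
  then show ?case using assms(3) prefix_order.trans by blast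
qed simp

lemma drop_generated:
  assumes "u \<in> generated X Y" "r < length u"
  shows "\<exists>v\<in>{X, Y}. \<exists>u'\<in>generated X Y. \<exists>k<length v. drop r u = drop k v @ u'"
  using assms
proof (induction arbitrary: r rule: generated.induct)
  case (left u)
  show ?case
  proof (cases "r < length X")
    case True
    then show ?thesis using left.hyps by (intro bexI[of _ X] bexI[of _ u] exI[of _ r]) auto
  next
    case False
    then show ?thesis using left.IH[of "r - length X"] left.prems by simp
  qed
next
  case (right u)
  show ?case
  proof (cases "r < length Y")
    case True
    then show ?thesis using right.hyps by (intro bexI[of _ Y] bexI[of _ u] exI[of _ r]) auto
  next
    case False
    then show ?thesis using right.IH[of "r - length Y"] right.prems by simp
  qed
qed simp

text \<open>The components are the two blocks, the common prefix of all block sequences, and the part of the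
  word before the first cut. The order of the two kinds of steps is the periodic pattern that the
  orbit bounds force.\<close>

fun stage :: "nat \<Rightarrow> nat list \<times> nat list \<times> nat list \<times> nat list" where
  "stage 0 = ([1], [0], [], [1])"
| "stage (Suc k) = (case stage k of (X, Y, w, S) \<Rightarrow>
     if 4 dvd k then (Y @ X, Y, Y @ w, S) else (X @ Y, X, X @ w, S @ Y))"

definition stX :: "nat \<Rightarrow> nat list" where "stX k = fst (stage k)"
definition stY :: "nat \<Rightarrow> nat list" where "stY k = fst (snd (stage k))"
definition stw :: "nat \<Rightarrow> nat list" where "stw k = fst (snd (snd (stage k)))"
definition stS :: "nat \<Rightarrow> nat list" where "stS k = snd (snd (snd (stage k)))"

lemma stage_0: "stX 0 = [1]" "stY 0 = [0]" "stw 0 = []" "stS 0 = [1]"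
  by (simp_all add: stX_def stY_def stw_def stS_def)

lemma stage_dvd:
  assumes "4 dvd k"
  shows "stX (Suc k) = stY k @ stX k" "stY (Suc k) = stY k" "stw (Suc k) = stY k @ stw k" "stS (Suc k) = stS k"
  using assms by (simp_all add: stX_def stY_def stw_def stS_def case_prod_unfold)

lemma stage_not_dvd:
  assumes "\<not> 4 dvd k"
  shows "stX (Suc k) = stX k @ stY k" "stY (Suc k) = stX k" "stw (Suc k) = stX k @ stw k" "stS (Suc k) = stS k @ stY k"
  using assms by (simp_all add: stX_def stY_def stw_def stS_def case_prod_unfold)

text \<open>The letters \<open>f\<close>, \<open>f'\<close> express that \<open>stw k\<close> cannot
  be lengthened as a common prefix; they change places at each step of the second branch. The
  constant 2 survives because block lengths and \<open>stw\<close> gain the same amount.\<close>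

lemma stage_inv:
  "stX k \<noteq> [] \<and> stY k \<noteq> [] \<and> suffix (stS k) (stX k) \<and> length (stX k) + length (stY k) = length (stw k) + 2 \<and>
   (\<exists>f f'. f \<noteq> f' \<and> prefix (stw k @ [f]) (stX k @ stw k) \<and> prefix (stw k @ [f']) (stY k @ stw k))"
proof (induction k)
  case (Suc k)
  then obtain f f' where IH: "stX k \<noteq> []" "stY k \<noteq> []" "suffix (stS k) (stX k)" "length (stX k) + length (stY k) = length (stw k) + 2"
    and f: "f \<noteq> f'" "prefix (stw k @ [f]) (stX k @ stw k)" "prefix (stw k @ [f']) (stY k @ stw k)" by blast
  have ext: "prefix (w @ [g]) (V @ U @ w)" if "prefix (w @ [g]) (V @ w)" "prefix w (U @ w)" for w g and U V :: "nat list"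
    using prefix_order.trans[OF that(1), of "V @ U @ w"] that(2) by simp
  have w: "prefix (stw k) (stX k @ stw k)" "prefix (stw k) (stY k @ stw k)"
    using f append_prefixD by blast+
  show ?case
  proof (cases "4 dvd k")
    case True
    have "prefix (stw (Suc k) @ [f]) (stX (Suc k) @ stw (Suc k))" "prefix (stw (Suc k) @ [f']) (stY (Suc k) @ stw (Suc k))"
      unfolding stage_dvd[OF True] using f ext[OF f(2) w(2)] by auto
    moreover have "suffix (stS (Suc k)) (stX (Suc k))" using IH(3) by (auto simp: stage_dvd[OF True] suffix_def)
    ultimately show ?thesis using IH f(1) by (auto simp: stage_dvd[OF True] simp del: append_assoc)
  next
    case False
    have "prefix (stw (Suc k) @ [f']) (stX (Suc k) @ stw (Suc k))" "prefix (stw (Suc k) @ [f]) (stY (Suc k) @ stw (Suc k))"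
      unfolding stage_not_dvd[OF False] using f ext[OF f(3) w(1)] by auto
    moreover have "suffix (stS (Suc k)) (stX (Suc k))" using IH(3) by (auto simp: stage_not_dvd[OF False] suffix_def)
    moreover have "f' \<noteq> f" using f(1) by simp
    ultimately have "\<exists>f f'. f \<noteq> f' \<and> prefix (stw (Suc k) @ [f]) (stX (Suc k) @ stw (Suc k)) \<and>
        prefix (stw (Suc k) @ [f']) (stY (Suc k) @ stw (Suc k))" "suffix (stS (Suc k)) (stX (Suc k))" by blast+
    then show ?thesis using IH by (simp add: stage_not_dvd[OF False])
  qed
qed (use stage_0 in \<open>auto intro!: exI[of _ 1] exI[of _ 0]\<close>)

lemma stage_prefix: "prefix (stw k) (stX k @ stw k)" "prefix (stw k) (stY k @ stw k)"
  using stage_inv[of k] append_prefixD by blast+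

text \<open>Later stages append only products of blocks of stage \<open>k\<close>, so the initial
  parts converge and the limit is cut into blocks of every stage.\<close>

lemma stS_extends: "k \<le> m \<Longrightarrow> \<exists>u\<in>generated (stX k) (stY k). stS m = stS k @ u"
proof -
  have gen: "k \<le> m \<Longrightarrow> stX m \<in> generated (stX k) (stY k) \<and> stY m \<in> generated (stX k) (stY k)" for m
  proof (induction m rule: dec_induct)
    case base
    show ?case using generated.left[OF generated.Nil, of "stX k" "stY k"]
        generated.right[OF generated.Nil, of "stY k" "stX k"] by simp
  next
    case (step m)
    then show ?case by (cases "4 dvd m") (auto simp: stage_dvd stage_not_dvd intro: generated_append)
  qed
  assume "k \<le> m"
  then show ?thesis
  proof (induction m rule: dec_induct)
    case base
    show ?case using generated.Nil by (intro bexI[of _ "[]"]) auto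
  next
    case (step m)
    then obtain u where u: "u \<in> generated (stX k) (stY k)" "stS m = stS k @ u" by blast
    show ?case
    proof (cases "4 dvd m")
      case True
      then show ?thesis using u stage_dvd by auto
    next
      case False
      then have "stS (Suc m) = stS k @ (u @ stY m)" using u stage_not_dvd by simp
      then show ?thesis using u generated_append gen step.hyps by (metis less_imp_le)
    qed
  qed
qed

lemma length_stS_ge: "m < length (stS (4 * m))"
proof (induction m)
  case (Suc m)
  have e: "4 * Suc m = Suc (Suc (Suc (Suc (4 * m))))" by simp
  have d: "4 dvd 4 * m" "\<not> 4 dvd Suc (4 * m)" "\<not> 4 dvd Suc (Suc (4 * m))" "\<not> 4 dvd Suc (Suc (Suc (4 * m)))"
    by presburger+
  have "1 \<le> length (stY (4 * m))" using stage_inv[of "4 * m"] by (cases "stY (4 * m)") auto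
  then show ?case using Suc unfolding e stage_dvd[OF d(1)] stage_not_dvd[OF d(2)] stage_not_dvd[OF d(3)] stage_not_dvd[OF d(4)]
    unfolding length_append by linarith
qed (simp add: stage_0)

text \<open>The limit of the words \<open>stS\<close>; stage \<open>4 * i\<close> is late enough to
  contain position \<open>i\<close>.\<close>

definition extremal_word :: "nat \<Rightarrow> nat" where
  "extremal_word i = stS (4 * i) ! i"

lemma factor_extremal_word: "factor extremal_word 0 (length (stS k)) = stS k"
proof -
  have "extremal_word i = stS k ! i" if i: "i < length (stS k)" for i
  proof -
    obtain u v where "stS (max k (4 * i)) = stS k @ u" "stS (max k (4 * i)) = stS (4 * i) @ v"
      using stS_extends[of k "max k (4 * i)"] stS_extends[of "4 * i" "max k (4 * i)"] by auto
    then show ?thesis using i length_stS_ge[of i] unfolding extremal_word_def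
      by (metis nth_append)
  qed
  then show ?thesis by (simp add: factor_eq_iff)
qed

lemma stS_long: "\<exists>m\<ge>k. \<exists>u\<in>generated (stX k) (stY k). n \<le> length u \<and> stS m = stS k @ u"
proof -
  define m where "m = 4 * (n + k + length (stS k))"
  have "k \<le> m" by (simp add: m_def)
  then obtain u where u: "u \<in> generated (stX k) (stY k)" "stS m = stS k @ u" using stS_extends by blast
  have "n \<le> length u" using length_stS_ge[of "n + k + length (stS k)"] u(2) unfolding m_def[symmetric] by simp
  then show ?thesis using u \<open>k \<le> m\<close> by blast
qed

lemma extremal_word_at_stS:
  "factor extremal_word (length (stS k)) (length (stw k)) = stw k"
proof -
  obtain m u where u: "u \<in> generated (stX k) (stY k)" "length (stw k) \<le> length u" "stS m = stS k @ u"
    using stS_long by blast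
  have "prefix (stw k) (u @ stw k)" by (rule prefix_generated[OF u(1) stage_prefix])
  then have w: "take (length (stw k)) u = stw k" using u(2) take_prefix by fastforce
  have "factor extremal_word (length (stS k)) (length (stw k)) = take (length (stw k)) (drop (length (stS k)) (factor extremal_word 0 (length (stS m))))"
    using take_drop_factor[of "length (stS k)" "length (stw k)" "length (stS m)" extremal_word 0] u by simp
  then show ?thesis unfolding factor_extremal_word using u(3) w by simp
qed

lemma extremal_word_cover:
  "\<exists>v\<in>{stX k, stY k}. \<exists>j<length v. factor extremal_word p (length (stw k)) = take (length (stw k)) (drop j (v @ stw k))"
proof -
  let ?w = "stw k" let ?n = "length (stw k)"
  obtain m u where u: "u \<in> generated (stX k) (stY k)" "Suc (p + ?n) \<le> length u" "stS m = stS k @ u"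
    using stS_long by blast
  have f: "factor extremal_word p ?n = take ?n (drop p (stS k @ u))"
    using take_drop_factor[of p ?n "length (stS m)" extremal_word 0] u unfolding factor_extremal_word by simp
  have cut: "take ?n (V @ u') = take ?n (V @ ?w)" if "?n \<le> length (V @ u')" "u' \<in> generated (stX k) (stY k)" for V u'
  proof -
    have "prefix ?w (u' @ ?w)" by (rule prefix_generated[OF that(2) stage_prefix])
    then obtain y where y: "u' @ ?w = ?w @ y" by (auto simp: prefix_def)
    have "take ?n (V @ u') = take ?n ((V @ u') @ ?w)" using that(1) by simp
    also have "\<dots> = take ?n ((V @ ?w) @ y)" using y by simp
    also have "\<dots> = take ?n (V @ ?w)" by (subst take_append) simp
    finally show ?thesis .
  qed
  obtain X0 where X0: "stX k = X0 @ stS k" using stage_inv[of k] by (auto simp: suffix_def)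
  show ?thesis
  proof (cases "p < length (stS k)")
    case True
    then have "factor extremal_word p ?n = take ?n (drop p (stS k) @ u)" using f by simp
    also have "\<dots> = take ?n (drop p (stS k) @ ?w)" using cut[of "drop p (stS k)" u] u by simp
    also have "\<dots> = take ?n (drop (length X0 + p) (stX k @ ?w))" using True by (simp add: X0)
    finally show ?thesis using True X0 by (intro bexI[of _ "stX k"] exI[of _ "length X0 + p"]) auto
  next
    case False
    obtain v u' j where v: "v \<in> {stX k, stY k}" "u' \<in> generated (stX k) (stY k)" "j < length v"
      "drop (p - length (stS k)) u = drop j v @ u'"
      using drop_generated[OF u(1), of "p - length (stS k)"] u(2) by fastforce
    have len: "?n \<le> length (drop j v @ u')" unfolding v(4)[symmetric] using u(2) by simp
    have "factor extremal_word p ?n = take ?n (drop j v @ u')" using f False v(4) by simp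
    also have "\<dots> = take ?n (drop j v @ ?w)" by (rule cut[OF len v(2)])
    also have "\<dots> = take ?n (drop j (v @ ?w))" using v(3) by simp
    finally show ?thesis using v by blast
  qed
qed

lemma card_factors_extremal_word:
  "card (factors extremal_word (length (stw k))) \<le> length (stw k) + 1"
  using card_factors_if_covered[OF _ _ stage_prefix extremal_word_cover, of k] stage_inv[of k] by linarith

text \<open>All factors of length 3 are visible at stage 2, with blocks 010 and 01 and common prefix
  010.\<close>

lemma extremal_word_sparse: "extremal_word i \<le> 1" "extremal_word i = 1 \<Longrightarrow> extremal_word (Suc i) = 0"
proof -
  have st: "stX 2 = [0, 1, 0]" "stY 2 = [0, 1]" "stw 2 = [0, 1, 0]"
    using stage_dvd[of 0] stage_not_dvd[of 1] stage_0 by (simp_all add: numeral_2_eq_2)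
  obtain v j where v: "v \<in> {[0, 1, 0], [0, 1]}" "j < length v"
    "factor extremal_word i 3 = take 3 (drop j (v @ [0, 1, 0 :: nat]))"
    using extremal_word_cover[of 2 i] unfolding st by (simp only: list.size numeral_3_eq_3 add_0_right add_Suc_right) blast
  have "j = 0 \<or> j = 1 \<or> (j = 2 \<and> v = [0, 1, 0])" using v(1,2) by auto
  then show "extremal_word i \<le> 1" "extremal_word i = 1 \<Longrightarrow> extremal_word (Suc i) = 0"
    using v by (auto simp: numeral_3_eq_3 factor_Suc_Cons)
qed

section \<open>Maximal repetitions of the extremal word\<close>

lemma stage_next_letter:
  obtains f f' where "f \<noteq> f'" "(stX k @ stw k) ! length (stw k) = f" "(stY k @ stw k) ! length (stw k) = f'"
proof -
  obtain f f' where f: "f \<noteq> f'" "prefix (stw k @ [f]) (stX k @ stw k)" "prefix (stw k @ [f']) (stY k @ stw k)"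
    using stage_inv[of k] by blast
  have "u ! length (stw k) = g" if "prefix (stw k @ [g]) u" for u g
    using that by (auto simp: prefix_def)
  then show thesis using that f by blast
qed

text \<open>Read off from the next stage, whose \<open>stw\<close> begins with the block that comes
  next.\<close>

lemma extremal_word_blocks:
  "factor extremal_word (length (stS k)) (length (stY k) + length (stw k)) = stY k @ stw k"
  "\<not> 4 dvd k \<Longrightarrow> factor extremal_word (length (stS k) + length (stY k)) (length (stX k) + length (stw k)) = stX k @ stw k"
proof -
  show 2: "factor extremal_word (length (stS k) + length (stY k)) (length (stX k) + length (stw k)) = stX k @ stw k"
    if "\<not> 4 dvd k"
    using extremal_word_at_stS[of "Suc k"] unfolding stage_not_dvd[OF that] by simp
  show "factor extremal_word (length (stS k)) (length (stY k) + length (stw k)) = stY k @ stw k"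
  proof (cases "4 dvd k")
    case True
    then show ?thesis using extremal_word_at_stS[of "Suc k"] unfolding stage_dvd[OF True] by simp
  next
    case False
    have "factor extremal_word 0 (length (stS k) + length (stY k)) = stS k @ stY k"
      using factor_extremal_word[of "Suc k"] unfolding stage_not_dvd[OF False] by simp
    then have Y: "factor extremal_word (length (stS k)) (length (stY k)) = stY k"
      by (simp add: factor_add)
    have "factor extremal_word (length (stS k) + length (stY k)) (length (stw k)) = take (length (stw k)) (stX k @ stw k)"
      unfolding 2[OF False, symmetric]
      using take_drop_factor[of 0 "length (stw k)" "length (stX k) + length (stw k)" extremal_word "length (stS k) + length (stY k)"]
      by simp
    then show ?thesis using Y take_prefix[OF stage_prefix(1)] by (simp only: factor_add)
  qed
qed

text \<open>The initial part followed by \<open>stw k\<close> has period |X|. It is followed by the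
  letter that continues \<open>Y\<close>, whereas the period would demand the one that continues
  \<open>X\<close>.\<close>

lemma extremal_word_repetition_short:
  assumes y: "2 \<le> length (stY k)"
  defines "n \<equiv> length (stY k) + length (stS k) - 2"
  shows "factor extremal_word 0 n = factor extremal_word (length (stX k)) n"
    and "extremal_word n \<noteq> extremal_word (length (stX k) + n)"
proof -
  let ?X = "stX k" and ?w = "stw k" and ?c = "length (stS k)"
  have len: "length ?X + length (stY k) = length ?w + 2" using stage_inv by blast
  obtain X0 where X0: "?X = X0 @ stS k" using stage_inv[of k] by (auto simp: suffix_def)
  have n: "n = ?c + length ?w - length ?X" using len y by (simp add: n_def)
  show "factor extremal_word 0 n = factor extremal_word (length ?X) n"
    unfolding n by (rule shift_repetition[OF _ _ extremal_word_at_stS stage_prefix(1)])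
      (simp_all add: X0 factor_extremal_word)
  obtain f f' where f: "f \<noteq> f'" "(?X @ ?w) ! length ?w = f" "(stY k @ ?w) ! length ?w = f'"
    by (rule stage_next_letter)
  have "extremal_word (?c + length ?w) = f'"
    using nth_if_factor_eq[OF extremal_word_blocks(1)[of k], of "length ?w"] f(3) stage_inv[of k] by simp
  moreover have "length ?X + n = ?c + length ?w" using len y by (simp add: n_def)
  moreover have "extremal_word n = f"
  proof -
    have "length ?w - length ?X < length ?w" "length ?X \<le> length ?w"
      using len y stage_inv[of k] by (simp_all add: length_greater_0_conv[symmetric] del: length_greater_0_conv)
    moreover from this have "extremal_word (?c + (length ?w - length ?X)) = ?w ! (length ?w - length ?X)"
      by (intro nth_if_factor_eq[OF extremal_word_at_stS])
    moreover have "?c + (length ?w - length ?X) = n" using calculation(2) by (simp add: n)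
    ultimately show ?thesis using f(2) by (simp add: nth_append)
  qed
  ultimately show "extremal_word n \<noteq> extremal_word (length ?X + n)" using f(1) by simp
qed

text \<open>\<open>stw k\<close> is read at two consecutive cuts, the first starting
  \<open>Y\<close> and the second \<open>X\<close>, so the letters after it differ.\<close>

lemma extremal_word_repetition_long:
  assumes k: "\<not> 4 dvd k"
  defines "n \<equiv> length (stX k) + length (stY k) - 2"
  shows "factor extremal_word (length (stS k)) n = factor extremal_word (length (stY k) + length (stS k)) n"
    and "extremal_word (length (stS k) + n) \<noteq> extremal_word (length (stY k) + length (stS k) + n)"
proof -
  let ?w = "stw k"
  have n: "n = length ?w" using stage_inv[of k] by (simp add: n_def)
  have pos: "0 < length (stX k)" "0 < length (stY k)" using stage_inv[of k] by auto
  note b = extremal_word_blocks(1)[of k] extremal_word_blocks(2)[OF k]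
  have X: "factor extremal_word (length (stY k) + length (stS k)) n = ?w"
    using arg_cong[OF b(2), of "take n"] take_prefix[OF stage_prefix(1), of k]
      take_drop_factor[of 0 n "length (stX k) + n" extremal_word "length (stY k) + length (stS k)"]
    by (simp add: n add.commute)
  then show "factor extremal_word (length (stS k)) n = factor extremal_word (length (stY k) + length (stS k)) n"
    using extremal_word_at_stS[of k] by (simp add: n)
  obtain f f' where f: "f \<noteq> f'" "(stX k @ ?w) ! length ?w = f" "(stY k @ ?w) ! length ?w = f'"
    by (rule stage_next_letter)
  have "extremal_word (length (stS k) + n) = f'" "extremal_word (length (stY k) + length (stS k) + n) = f"
    using nth_if_factor_eq[OF b(1), of n] nth_if_factor_eq[OF b(2), of n] f pos by (simp_all add: n add.commute)
  then show "extremal_word (length (stS k) + n) \<noteq> extremal_word (length (stY k) + length (stS k) + n)" using f(1) by simp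
qed

section \<open>Lengths of the stages and ratios of consecutive exponents\<close>

lemma stage_lengths:
  fixes i :: nat
  defines "x \<equiv> length (stX (4 * i))" and "y \<equiv> length (stY (4 * i))" and "c \<equiv> length (stS (4 * i))"
  shows "length (stX (4 * i + 1)) = x + y" "length (stY (4 * i + 1)) = y" "length (stS (4 * i + 1)) = c"
    "length (stX (4 * i + 2)) = x + 2 * y" "length (stY (4 * i + 2)) = x + y" "length (stS (4 * i + 2)) = c + y"
    "length (stX (4 * i + 3)) = 2 * x + 3 * y" "length (stY (4 * i + 3)) = x + 2 * y"
    "length (stS (4 * i + 3)) = c + x + 2 * y"
    "length (stX (4 * Suc i)) = 3 * x + 5 * y" "length (stY (4 * Suc i)) = 2 * x + 3 * y"
    "length (stS (4 * Suc i)) = c + 2 * x + 4 * y"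
proof -
  have e: "4 * i + 1 = Suc (4 * i)" "4 * i + 2 = Suc (Suc (4 * i))" "4 * i + 3 = Suc (Suc (Suc (4 * i)))"
    "4 * Suc i = Suc (Suc (Suc (Suc (4 * i))))" by simp_all
  have d: "4 dvd 4 * i" "\<not> 4 dvd Suc (4 * i)" "\<not> 4 dvd Suc (Suc (4 * i))" "\<not> 4 dvd Suc (Suc (Suc (4 * i)))"
    by presburger+
  note st = stage_dvd[OF d(1)] stage_not_dvd[OF d(2)] stage_not_dvd[OF d(3)] stage_not_dvd[OF d(4)]
  show "length (stX (4 * i + 1)) = x + y" "length (stY (4 * i + 1)) = y" "length (stS (4 * i + 1)) = c"
    "length (stX (4 * i + 2)) = x + 2 * y" "length (stY (4 * i + 2)) = x + y" "length (stS (4 * i + 2)) = c + y"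
    "length (stX (4 * i + 3)) = 2 * x + 3 * y" "length (stY (4 * i + 3)) = x + 2 * y"
    "length (stS (4 * i + 3)) = c + x + 2 * y"
    "length (stX (4 * Suc i)) = 3 * x + 5 * y" "length (stY (4 * Suc i)) = 2 * x + 3 * y"
    "length (stS (4 * Suc i)) = c + 2 * x + 4 * y"
    unfolding e st length_append x_def y_def c_def by simp_all
qed

text \<open>These are the invariants of \<open>quadratic_orbit_bound\<close>; the three initial
  lengths 1 give them the values 0 and, in absolute value, 3.\<close>

lemma stage_length_relations:
  fixes i :: nat
  defines "x \<equiv> real (length (stX (4 * i)))" and "y \<equiv> real (length (stY (4 * i)))"
    and "c \<equiv> real (length (stS (4 * i)))"
  shows "3 * (y + c) = 2 * x + 4 * y" "\<bar>2 * x\<^sup>2 - 5 * y\<^sup>2\<bar> = 3" "y \<le> x" "x \<le> 2 * y" "real (Suc i) \<le> y"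
proof -
  have "3 * (y + c) = 2 * x + 4 * y \<and> \<bar>2 * x\<^sup>2 - 5 * y\<^sup>2\<bar> = 3 \<and> y \<le> x \<and> x \<le> 2 * y \<and> real (Suc i) \<le> y"
    unfolding x_def y_def c_def
  proof (induction i)
    case 0
    then show ?case by (simp add: stage_0)
  next
    case (Suc i)
    define x y c where "x = real (length (stX (4 * i)))" and "y = real (length (stY (4 * i)))"
      and "c = real (length (stS (4 * i)))"
    have IH: "3 * (y + c) = 2 * x + 4 * y" "\<bar>2 * x\<^sup>2 - 5 * y\<^sup>2\<bar> = 3" "y \<le> x" "x \<le> 2 * y" "real (Suc i) \<le> y"
      using Suc by (simp_all add: x_def y_def c_def)
    have "2 * (3 * x + 5 * y)\<^sup>2 - 5 * (2 * x + 3 * y)\<^sup>2 = - (2 * x\<^sup>2 - 5 * y\<^sup>2)"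
      by (simp add: power2_eq_square algebra_simps)
    then have "\<bar>2 * (3 * x + 5 * y)\<^sup>2 - 5 * (2 * x + 3 * y)\<^sup>2\<bar> = 3" using IH(2) by simp
    moreover have "real (length (stX (4 * Suc i))) = 3 * x + 5 * y" "real (length (stY (4 * Suc i))) = 2 * x + 3 * y"
      "real (length (stS (4 * Suc i))) = c + 2 * x + 4 * y"
      unfolding stage_lengths x_def y_def c_def by simp_all
    ultimately show ?case using IH by simp
  qed
  then show "3 * (y + c) = 2 * x + 4 * y" "\<bar>2 * x\<^sup>2 - 5 * y\<^sup>2\<bar> = 3" "y \<le> x" "x \<le> 2 * y" "real (Suc i) \<le> y" by blast+
qed

text \<open>Counterpart of \<open>quadratic_orbit_bound\<close>: the same invariants keep T/x below
  every \<open>s\<close> above the limit.\<close>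

lemma stage_ratio:
  fixes s :: real
  assumes s: "2/3 + 4/15 * sqrt 10 < s"
  shows "\<exists>i0. \<forall>i\<ge>i0. real (length (stY (4 * i)) + length (stS (4 * i))) \<le> s * real (length (stX (4 * i)))"
proof -
  define r where "r = sqrt 10 / 5"
  define d where "d = (s - (2/3 + 4/15 * sqrt 10)) * (3/4)"
  have d: "d > 0" and r: "r > 0" and r2: "r\<^sup>2 = 2/5"
    using s by (auto simp: d_def r_def power_divide)
  have s_eq: "s = 2/3 + 4/3 * (r + d)"
    by (simp add: d_def r_def field_simps)
  obtain i0 :: nat where i0: "real i0 > 3 / (5 * (r * d))" using reals_Archimedean2 by blast
  have "real (length (stY (4 * i)) + length (stS (4 * i))) \<le> s * real (length (stX (4 * i)))" if "i \<ge> i0" for i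
  proof -
    define x y c where "x = real (length (stX (4 * i)))" and "y = real (length (stY (4 * i)))"
      and "c = real (length (stS (4 * i)))"
    have R: "3 * (y + c) = 2 * x + 4 * y" "\<bar>2 * x\<^sup>2 - 5 * y\<^sup>2\<bar> = 3" "y \<le> x" "x \<le> 2 * y" "real (Suc i) \<le> y"
      unfolding x_def y_def c_def by (rule stage_length_relations)+
    have x1: "1 \<le> x" and xi: "3 / (5 * (r * d)) \<le> x" using R(3,5) i0 that by simp_all
    have "3 \<le> 5 * (r * d) * x" using xi d r by (simp add: field_simps)
    also have "\<dots> \<le> 5 * (r * d) * x\<^sup>2" using x1 d r by (intro mult_left_mono) (auto simp: power2_eq_square)
    finally have "y\<^sup>2 \<le> 2/5 * x\<^sup>2 + (r * d) * x\<^sup>2" using R(2) by simp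
    also have "\<dots> \<le> ((r + d) * x)\<^sup>2"
    proof -
      have "((r + d) * x)\<^sup>2 = 2/5 * x\<^sup>2 + 2 * ((r * d) * x\<^sup>2) + d\<^sup>2 * x\<^sup>2"
        unfolding r2[symmetric] by (simp add: power2_eq_square algebra_simps)
      moreover have "0 \<le> (r * d) * x\<^sup>2" "0 \<le> d\<^sup>2 * x\<^sup>2" using r d by simp_all
      ultimately show ?thesis by linarith
    qed
    finally have "y \<le> (r + d) * x" by (rule power2_le_imp_le) (use r d x1 in simp)
    then have "3 * (y + c) \<le> 2 * x + 4 * ((r + d) * x)" using R(1) by linarith
    also have "\<dots> = 3 * (s * x)" unfolding s_eq by (simp add: field_simps)
    finally have "y + c \<le> s * x" by simp
    then show ?thesis by (simp add: x_def y_def c_def)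
  qed
  then show ?thesis by blast
qed

text \<open>One period of stages gives the exponents x, y + c, x + 2y, x + 2y + c, 2x + 3y, 2x + 4y
  + c, 3x + 5y. Only the first ratio approaches the critical value; the others are at most 3/2.
  \<open>G\<close> stands for an approximation linking consecutive exponents.\<close>

lemma extremal_word_cover_ratio:
  fixes s :: real and G :: "nat \<Rightarrow> nat \<Rightarrow> bool"
  assumes s: "2/3 + 4/15 * sqrt 10 < s"
    and short: "\<And>k. 2 \<le> length (stY k) \<Longrightarrow> G (length (stX k)) (length (stY k) + length (stS k))"
    and long: "\<And>k. \<not> 4 dvd k \<Longrightarrow> G (length (stY k) + length (stS k)) (length (stX k) + length (stY k))"
  shows "\<exists>v0. \<forall>v\<ge>v0. \<exists>t t'. t \<le> v \<and> v < t' \<and> real t' \<le> s * real t \<and> G t t'"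
proof -
  have s2: "3/2 \<le> s"
  proof -
    have "3.13 \<le> sqrt 10" by (rule real_le_rsqrt) (simp add: power2_eq_square)
    then show ?thesis using s by simp
  qed
  obtain i1 where i1: "\<And>i. i \<ge> i1 \<Longrightarrow> real (length (stY (4 * i)) + length (stS (4 * i))) \<le> s * real (length (stX (4 * i)))"
    using stage_ratio[OF s] by blast
  define X where "X i = length (stX (4 * i))" for i
  have X_ge: "Suc i \<le> X i" for i
    using stage_length_relations(3,5)[of i] unfolding X_def by linarith
  show ?thesis
  proof (rule exI[of _ "X (Suc i1)"], intro allI impI)
    fix v assume v: "v \<ge> X (Suc i1)"
    \<comment> \<open>Picks the period of four stages whose range of exponents contains
      \<open>v\<close>.\<close>
    define i where "i = (GREATEST i. X i \<le> v)"
    have bd: "j \<le> v" if "X j \<le> v" for j using X_ge[of j] that by linarith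
    have iv: "X i \<le> v" unfolding i_def by (rule GreatestI_nat[where P = "\<lambda>i. X i \<le> v", OF v bd])
    have i_ge: "Suc i1 \<le> i" unfolding i_def by (rule Greatest_le_nat[where P = "\<lambda>i. X i \<le> v", OF v bd])
    have vi: "v < X (Suc i)"
    proof (rule ccontr)
      assume "\<not> ?thesis"
      then have "X (Suc i) \<le> v" by simp
      from Greatest_le_nat[of "\<lambda>i. X i \<le> v", OF this bd] have "Suc i \<le> i" unfolding i_def[symmetric] .
      then show False by simp
    qed
    define x y c where "x = length (stX (4 * i))" and "y = length (stY (4 * i))" and "c = length (stS (4 * i))"
    note len = stage_lengths[of i, folded x_def y_def c_def]
    have R: "3 * (real y + real c) = 2 * real x + 4 * real y" "real y \<le> real x" "real x \<le> 2 * real y" "real (Suc i) \<le> real y"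
      unfolding x_def y_def c_def by (rule stage_length_relations)+
    have y2: "2 \<le> y" using R(4) i_ge by simp
    have nd: "\<not> 4 dvd 4 * i + 1" "\<not> 4 dvd 4 * i + 2" "\<not> 4 dvd 4 * i + 3" by presburger+
    have eqs: "x + y + y = x + 2 * y" "x + y + (c + y) = x + 2 * y + c" "x + 2 * y + (x + y) = 2 * x + 3 * y"
      "x + 2 * y + (c + x + 2 * y) = 2 * x + 4 * y + c" "2 * x + 3 * y + (x + 2 * y) = 3 * x + 5 * y" by simp_all
    have "2 \<le> length (stY (4 * i))" "2 \<le> length (stY (4 * i + 2))" "2 \<le> length (stY (4 * i + 3))"
      using y2 unfolding len y_def by simp_all
    note G = short[OF this(1), folded x_def y_def c_def] long[OF nd(1), unfolded len eqs] short[OF this(2), unfolded len eqs]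
      long[OF nd(2), unfolded len eqs] short[OF this(3), unfolded len eqs] long[OF nd(3), unfolded len eqs]
    have ratio: "real t' \<le> s * real t" if "2 * real t' \<le> 3 * real t" for t t'
      using that s2 mult_right_mono[of "3/2" s "real t"] by simp
    have q1: "real (y + c) \<le> s * real x" unfolding x_def y_def c_def by (rule i1) (use i_ge in simp)
    have q2: "real (x + 2 * y) \<le> s * real (y + c)" "real (x + 2 * y + c) \<le> s * real (x + 2 * y)"
      "real (2 * x + 3 * y) \<le> s * real (x + 2 * y + c)" "real (2 * x + 4 * y + c) \<le> s * real (2 * x + 3 * y)"
      "real (3 * x + 5 * y) \<le> s * real (2 * x + 4 * y + c)"
      using R by (intro ratio; simp)+
    note q = q1 q2
    have *: "x \<le> v" "v < 3 * x + 5 * y" using iv vi unfolding X_def len by (simp_all add: x_def)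
    consider "v < y + c" | "y + c \<le> v" "v < x + 2 * y" | "x + 2 * y \<le> v" "v < x + 2 * y + c"
      | "x + 2 * y + c \<le> v" "v < 2 * x + 3 * y" | "2 * x + 3 * y \<le> v" "v < 2 * x + 4 * y + c"
      | "2 * x + 4 * y + c \<le> v" by linarith
    then show "\<exists>t t'. t \<le> v \<and> v < t' \<and> real t' \<le> s * real t \<and> G t t'"
    proof cases
      case 1
      then show ?thesis using * q(1) G(1) by blast
    next
      case 2
      then show ?thesis using q(2) G(2) by blast
    next
      case 3
      then show ?thesis using q(3) G(3) by blast
    next
      case 4
      then show ?thesis using q(4) G(4) by blast
    next
      case 5
      then show ?thesis using q(5) G(5) by blast
    next
      case 6
      then show ?thesis using * q(6) G(6) by blast
    qed
  qed
qed

lemma finite_approximants_extremal: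
  assumes b: "b \<ge> 2" and mu: "5/3 + 4/15 * sqrt 10 < mu"
  shows "finite (approximants (expansion extremal_word b 0) mu)"
proof -
  interpret sparse_binary_word extremal_word b
    by unfold_locales (use b extremal_word_sparse in auto)
  let ?xi = "expansion extremal_word b 0"
  \<comment> \<open>Midway between the critical slope and \<open>mu - 1\<close>, so that both
    inequalities are strict.\<close>
  define s where "s = ((2/3 + 4/15 * sqrt 10) + (mu - 1)) / 2"
  have s: "2/3 + 4/15 * sqrt 10 < s" "1 + s < mu" using mu by (simp_all add: s_def field_simps)
  have "3 \<le> sqrt 10" by (rule real_le_rsqrt) simp
  then have s1: "1 \<le> s" using s by simp
  define G where "G t t' \<longleftrightarrow> (\<exists>P Q. 1 \<le> Q \<and> real_of_int Q \<le> real b ^ t \<and>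
    1/4 \<le> \<bar>real_of_int Q * ?xi - real_of_int P\<bar> * real b ^ t' \<and>
    \<bar>real_of_int Q * ?xi - real_of_int P\<bar> * real b ^ t' \<le> real b ^ 2)" for t t'
  have "\<exists>v0. \<forall>v\<ge>v0. \<exists>t t'. t \<le> v \<and> v < t' \<and> real t' \<le> s * real t \<and> G t t'"
  proof (rule extremal_word_cover_ratio[OF s(1)])
    fix k assume k: "2 \<le> length (stY k)"
    have "0 < length (stX k)" using stage_inv[of k] by auto
    note * = repetition_approximation[OF this extremal_word_repetition_short(1)[OF k],
        unfolded add_0, OF extremal_word_repetition_short(2)[OF k]]
    have "length (stY k) + length (stS k) - 2 + 2 = length (stY k) + length (stS k)" using k by linarith
    then show "G (length (stX k)) (length (stY k) + length (stS k))"
      using * unfolding G_def by (simp only:)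
  next
    fix k :: nat assume k: "\<not> 4 dvd k"
    have pos: "0 < length (stX k)" "0 < length (stY k)" using stage_inv[of k] by auto
    have "length (stS k) < length (stY k) + length (stS k)" using pos by simp
    note * = repetition_approximation[OF this extremal_word_repetition_long[OF k]]
    show "G (length (stY k) + length (stS k)) (length (stX k) + length (stY k))"
    proof -
      have "length (stX k) + length (stY k) - 2 + 2 = length (stX k) + length (stY k)" using pos by linarith
      then show ?thesis using * unfolding G_def by (simp only:)
    qed
  qed
  then obtain v0 where v0: "\<And>v. v \<ge> v0 \<Longrightarrow> \<exists>t t'. t \<le> v \<and> v < t' \<and> real t' \<le> s * real t \<and> G t t'" by blast
  show ?thesis
  proof (rule finite_approximants[OF b s1 s(2)])
    show "(0 :: real) < 1/4" "1 \<le> real b ^ 2" using b by simp_all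
  next
    fix v assume "v \<ge> v0"
    then show "\<exists>t t' P Q. t \<le> v \<and> v < t' \<and> real t' \<le> s * real t \<and> 1 \<le> Q \<and> real_of_int Q \<le> real b ^ t \<and>
      1/4 \<le> \<bar>real_of_int Q * ?xi - real_of_int P\<bar> * real b ^ t' \<and>
      \<bar>real_of_int Q * ?xi - real_of_int P\<bar> * real b ^ t' \<le> real b ^ 2"
      using v0[of v] unfolding G_def by blast
  qed
qed

theorem theorem4p6:
  shows "(\<forall>xi::real. xi \<notin> \<rat> \<longrightarrow>
            irrationality_exponent xi < ereal (5/3 + 4/15 * sqrt 10) \<longrightarrow>
            (\<forall>b::nat. b \<ge> 2 \<longrightarrow>
               filterlim (\<lambda>n. real (complexity n xi b) - real n) at_top sequentially))
       \<and> (\<forall>b::nat. b \<ge> 2 \<longrightarrow>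
            (\<exists>xi::real. xi \<notin> \<rat> \<and>
               irrationality_exponent xi = ereal (5/3 + 4/15 * sqrt 10) \<and>
               (\<forall>n\<ge>1. complexity n xi b = n + 1)))"
proof (intro conjI allI impI)
  fix xi :: real and b :: nat
  assume xi: "xi \<notin> \<rat>" and mu: "irrationality_exponent xi < ereal (5/3 + 4/15 * sqrt 10)" and b: "b \<ge> 2"
  show "filterlim (\<lambda>n. real (complexity n xi b) - real n) at_top sequentially"
  proof (rule ccontr)
    assume "\<not> ?thesis"
    then obtain N where "\<forall>n\<ge>N. complexity (Suc n) xi b \<le> Suc (complexity n xi b)"
      using low_complexity_if_not_tendsto[OF xi b] by blast
    then show False using irrationality_exponent_ge_if_low_complexity[OF xi b] mu by (meson leD)
  qed
next
  fix b :: nat assume b: "b \<ge> 2"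
  interpret sparse_binary_word extremal_word b
    by unfold_locales (use b extremal_word_sparse in auto)
  let ?xi = "expansion extremal_word b 0"
  have irr: "?xi \<notin> \<rat>"
    by (rule irrational_if_finite_approximants[OF finite_approximants_extremal[OF b, of "5/3 + 4/15 * sqrt 10 + 1"]]) simp
  have comp: "complexity n ?xi b = n + 1" for n
  proof -
    \<comment> \<open>At the length of \<open>stw k\<close>, which is at least \<open>n\<close>, the
      complexity exceeds the length by at most 1; since p(n) - n never decreases, the same holds at
      \<open>n\<close>.\<close>
    define k where "k = 4 * n"
    have "n \<le> length (stw k)"
      using length_stS_ge[of n] stage_inv[of k] suffix_length_le[of "stS k" "stX k"] by (cases "stY k") (auto simp: k_def)
    then have "complexity n ?xi b + (length (stw k) - n) \<le> length (stw k) + 1"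
      using complexity_minus_mono[OF irr b] card_factors_extremal_word[of k]
      unfolding complexity_eq_card_factors digit_word_expansion by (meson order_trans)
    then show ?thesis using complexity_ge[OF irr b, of n] \<open>n \<le> length (stw k)\<close> by linarith
  qed
  have "irrationality_exponent ?xi \<le> ereal (5/3 + 4/15 * sqrt 10)"
    unfolding irrationality_exponent_eq
  proof (rule Sup_least)
    fix e assume "e \<in> {ereal mu |mu. infinite (approximants ?xi mu)}"
    then obtain mu where "e = ereal mu" "infinite (approximants ?xi mu)" by blast
    then show "e \<le> ereal (5/3 + 4/15 * sqrt 10)" using finite_approximants_extremal[OF b, of mu] by (simp add: not_less[symmetric]) blast
  qed
  \<comment> \<open>The lower bound is the argument of the first part, as the complexity grows by
    exactly one.\<close>
  moreover have "ereal (5/3 + 4/15 * sqrt 10) \<le> irrationality_exponent ?xi"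
    by (rule irrationality_exponent_ge_if_low_complexity[OF irr b, of 0]) (simp add: comp)
  ultimately have "irrationality_exponent ?xi = ereal (5/3 + 4/15 * sqrt 10)" by (rule antisym)
  then show "\<exists>xi::real. xi \<notin> \<rat> \<and> irrationality_exponent xi = ereal (5/3 + 4/15 * sqrt 10) \<and>
      (\<forall>n\<ge>1. complexity n xi b = n + 1)"
    using irr comp by blast
qed

end
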